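(* For each positive integer $N$, let $T(N)$ be the maximum, over all graphs $G$ on $N$ vertices and all families of $N$ pairwise edge-disjoint cliques of $G$ that together cover all edges of $G$, of the sum of the numbers of vertices of these $N$ cliques. Let $B(N) = N f^{-1}(N-1)$, where $f(M) = M(M-1)$ and $f^{-1}$ is the inverse of $f$ on $[1,\infty)$. Then $$\lim_{N \to \infty} \frac{T(N)}{B(N)} = 1.$$
   Context: A clique of $G$ is a complete subgraph of $G$ with at least one vertex. Edge-disjoint means no edge lies in two of the cliques; covering means every edge of $G$ lies in one of the cliques. (Such families always exist for some graph on $N$ vertices, e.g. the edgeless graph with $N$ single-vertex cliques, so $T(N)$ is well defined.) *)

theory Defs
  imports "HOL-Analysis.Analysis" "HOL-Library.Ramsey" "HOL-Library.Disjoint_Sets"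
begin

text \<open>A finite simple graph is a pair of a finite vertex set and a set of two-element subsets of it.\<close>

definition simple_graph :: "'a set \<Rightarrow> 'a set set \<Rightarrow> bool" where
  "simple_graph V E \<longleftrightarrow> finite V \<and> E \<subseteq> [V]\<^bsup>2\<^esup>"

text \<open>A complete subgraph is determined by its vertex set \<open>C\<close>; its edge set is \<open>[C]\<^bsup>2\<^esup>\<close>.
  The library's \<open>clique\<close> only demands that distinct vertices be adjacent, so nonemptiness and
  containment in the vertex set are added here.\<close>

definition is_clique_of :: "'a set \<Rightarrow> 'a set set \<Rightarrow> 'a set \<Rightarrow> bool" where
  "is_clique_of V E C \<longleftrightarrow> C \<noteq> {} \<and> C \<subseteq> V \<and> clique C E"

text \<open>Families are indexed, so one single-vertex clique may occur under several indices;
  disjointness of the edge sets prevents this for larger cliques.\<close>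

definition clique_decomposition ::
    "'a set \<Rightarrow> 'a set set \<Rightarrow> nat \<Rightarrow> (nat \<Rightarrow> 'a set) \<Rightarrow> bool" where
  "clique_decomposition V E k C \<longleftrightarrow>
     (\<forall>i<k. is_clique_of V E (C i)) \<and>
     disjoint_family_on (\<lambda>i. [C i]\<^bsup>2\<^esup>) {..<k} \<and>
     E \<subseteq> (\<Union>i<k. [C i]\<^bsup>2\<^esup>)"

definition clique_sums :: "nat \<Rightarrow> nat set" where
  "clique_sums N = {\<Sum>i<N. card (C i) | (V :: nat set) E C.
     simple_graph V E \<and> card V = N \<and> clique_decomposition V E N C}"

definition T_max :: "nat \<Rightarrow> nat" where
  "T_max N = Max (clique_sums N)"

text \<open>\<^const>\<open>Max\<close> is only meaningful on finite nonempty sets.\<close>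

lemma finite_clique_sums: "finite (clique_sums N)"
proof (rule finite_subset)
  show "clique_sums N \<subseteq> {..N * N}"
  proof
    fix s assume "s \<in> clique_sums N"
    then obtain V :: "nat set" and E C where s: "s = (\<Sum>i<N. card (C i))"
      and V: "finite V" "card V = N" and C: "\<And>i. i < N \<Longrightarrow> C i \<subseteq> V"
      unfolding clique_sums_def simple_graph_def clique_decomposition_def is_clique_of_def
      by blast
    have "s \<le> (\<Sum>i<N. N)"
      unfolding s using V C by (intro sum_mono) (metis card_mono lessThan_iff)
    then show "s \<in> {..N * N}" by simp
  qed
qed simp

lemma clique_sums_nonempty: "clique_sums N \<noteq> {}"
proof -
  have "clique_decomposition {..<N} {} N (\<lambda>i. {i})"
    by (auto simp: clique_decomposition_def is_clique_of_def clique_def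
        disjoint_family_on_def nsets_def card_2_iff)
  moreover have "simple_graph {..<N} {}"
    by (simp add: simple_graph_def)
  ultimately have "(\<Sum>i<N. card {i}) \<in> clique_sums N"
    unfolding clique_sums_def mem_Collect_eq
    by (intro exI[of _ "{..<N}"] exI[of _ "{}"] exI[of _ "\<lambda>i. {i}"]) simp
  then show ?thesis by blast
qed

definition f_quad :: "real \<Rightarrow> real" where
  "f_quad M = M * (M - 1)"

definition B_bound :: "nat \<Rightarrow> real" where
  "B_bound N = real N * the_inv_into {1..} f_quad (real N - 1)"

text \<open>The inverse occurring in \<^const>\<open>B_bound\<close> is well defined on the nonnegative reals.\<close>

lemma bij_betw_f_quad: "bij_betw f_quad {1..} {0..}"
  unfolding bij_betw_def
proof
  show "inj_on f_quad {1..}"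
  proof (rule inj_onI)
    fix x y :: real assume xy: "x \<in> {1..}" "y \<in> {1..}" "f_quad x = f_quad y"
    then have "(x - y) * (x + y - 1) = 0" by (simp add: f_quad_def algebra_simps)
    then show "x = y" using xy by auto
  qed
  show "f_quad ` {1..} = {0..}"
  proof
    show "f_quad ` {1..} \<subseteq> {0..}" by (auto simp: f_quad_def)
    show "{0..} \<subseteq> f_quad ` {1..}"
    proof
      fix y :: real assume y: "y \<in> {0..}"
      have "1 \<le> sqrt (1 + 4 * y)" using y by simp
      moreover have "y = f_quad ((1 + sqrt (1 + 4 * y)) / 2)"
        using y by (simp add: f_quad_def field_simps)
      ultimately show "y \<in> f_quad ` {1..}" by (intro image_eqI) auto
    qed
  qed
qed

end

theory Submission
  imports Defs "HOL-Number_Theory.Cong" "HOL-Number_Theory.Prime_Powers"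
    "HOL-Complex_Analysis.Complex_Analysis" "HOL-Real_Asymp.Real_Asymp"
begin

text \<open>Counting pairs of vertices gives \<open>\<Sum> m (m - 1) \<le> N (N - 1)\<close> for the clique sizes \<open>m\<close>, and convexity turns
  this into \<open>T(N) \<le> B(N)\<close>. Conversely, for a prime \<open>q\<close> with \<open>q\<^sup>2 \<le> N\<close> the non-vertical lines of the affine plane of
  order \<open>q\<close>, padded with isolated vertices and one-vertex cliques, give \<open>T(N) \<ge> q\<^sup>3\<close>. Since \<open>B(N) \<sim> N powr (3/2)\<close>,
  it remains to find primes \<open>q \<sim> sqrt N\<close>, that is, primes in \<open>((1 - \<epsilon>) x, x]\<close> for all large \<open>x\<close>.

  The latter is shown by a Wiener-Ikehara argument that stops short of the prime number theorem. The
  Dirichlet series of \<open>\<Lambda>(n) - 1\<close> extends holomorphically across the line \<open>Re s = 1\<close>, because \<open>\<zeta>\<close> has no zeros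
  there. Testing it against a Fejer kernel \<open>K\<close> on a bounded part of that line, the Riemann-Lebesgue lemma
  gives \<open>\<Sum> (\<Lambda>(n) - 1) / n * K(y - ln n) \<longlongrightarrow> 0\<close> as \<open>y \<longlongrightarrow> \<infinity>\<close>. Since the terms with \<open>ln n\<close> far from \<open>y\<close> contribute
  arbitrarily little for a sharp kernel, \<open>\<Sum> \<Lambda>(n) / n\<close> over \<open>|ln n - y| < \<epsilon>\<close> stays bounded away from \<open>0\<close>, and the
  proper prime powers are too sparse to account for this.\<close>

section \<open>Dirichlet series with logarithmically bounded coefficients\<close>

text \<open>One growth class for the four coefficient sequences 1, \<open>ln n\<close>, \<Lambda>(n)
  and \<Lambda>(n) - 1. Index 0 is left free: its term in \<open>dirichlet\<close> is 0 because
  \<open>0 powr _ = 0\<close>.\<close>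

definition log_bounded :: "(nat \<Rightarrow> real) \<Rightarrow> bool" where
  "log_bounded a \<longleftrightarrow> (\<forall>n>0. \<bar>a n\<bar> \<le> 1 + ln (real n))"

definition dirichlet :: "(nat \<Rightarrow> real) \<Rightarrow> complex \<Rightarrow> complex" where
  "dirichlet a s = (\<Sum>n. of_real (a n) * of_nat n powr (- s))"

lemma log_bounded_one: "log_bounded (\<lambda>_. 1)"
  by (auto simp: log_bounded_def)

lemma log_bounded_ln: "log_bounded (\<lambda>n. ln (real n))"
  by (auto simp: log_bounded_def)

lemma log_bounded_mangoldt: "log_bounded mangoldt"
  unfolding log_bounded_def using mangoldt_le abs_mangoldt by (smt (verit))

lemma log_bounded_mangoldt_diff: "log_bounded (\<lambda>n. mangoldt n - 1)"
  unfolding log_bounded_def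
proof (intro allI impI)
  fix n :: nat assume "n > 0"
  then have "mangoldt n \<le> ln (real n)" "0 \<le> (mangoldt n :: real)" "0 \<le> ln (real n)"
    using mangoldt_le mangoldt_nonneg by auto
  then show "\<bar>mangoldt n - 1\<bar> \<le> 1 + ln (real n)" by linarith
qed

lemma norm_of_nat_powr: "norm (of_nat n powr s :: complex) = real n powr Re s"
  by (simp add: norm_powr_real_powr)

text \<open>Half of the excess of \<sigma> over 1 is spent on the logarithm, by
  \<open>ln n \<le> n powr \<eta> / \<eta>\<close>; the other half keeps the exponent below
  -1.\<close>

lemma summable_log_powr:
  fixes \<sigma> :: real
  assumes "\<sigma> > 1"
  shows "summable (\<lambda>n. (1 + ln (real n)) * real n powr (- \<sigma>))"
proof (rule summable_comparison_test_ev)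
  define \<eta> where "\<eta> = (\<sigma> - 1) / 2"
  have \<eta>: "\<eta> > 0" "\<eta> - \<sigma> < -1" using assms by (auto simp: \<eta>_def field_simps)
  show "summable (\<lambda>n. (1 + 1 / \<eta>) * real n powr (\<eta> - \<sigma>))"
    using \<eta> by (intro summable_mult) (simp add: summable_real_powr_iff)
  show "\<forall>\<^sub>F n in sequentially. norm ((1 + ln (real n)) * real n powr (- \<sigma>))
        \<le> (1 + 1 / \<eta>) * real n powr (\<eta> - \<sigma>)"
    using eventually_ge_at_top[of 1]
  proof eventually_elim
    case (elim n)
    have "ln (real n) \<le> real n powr \<eta> / \<eta>" using elim \<eta> by (intro ln_powr_bound) auto
    moreover have "1 \<le> real n powr \<eta>" using elim \<eta> by (simp add: ge_one_powr_ge_zero)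
    ultimately have "1 + ln (real n) \<le> (1 + 1 / \<eta>) * real n powr \<eta>"
      by (simp add: algebra_simps)
    then have "(1 + ln (real n)) * real n powr (- \<sigma>) \<le> ((1 + 1 / \<eta>) * real n powr \<eta>) * real n powr (- \<sigma>)"
      by (intro mult_right_mono) auto
    also have "\<dots> = (1 + 1 / \<eta>) * real n powr (\<eta> - \<sigma>)"
      using elim by (simp add: powr_diff powr_minus field_simps)
    finally show ?case using elim by simp
  qed
qed

lemma norm_dirichlet_term_le:
  assumes "log_bounded a" "\<sigma> \<le> Re s"
  shows "norm (of_real (a n) * of_nat n powr (- s) :: complex) \<le> (1 + ln (real n)) * real n powr (- \<sigma>)"
proof (cases "n = 0")
  case False
  then have "\<bar>a n\<bar> * real n powr (- Re s) \<le> (1 + ln (real n)) * real n powr (- \<sigma>)"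
    using assms by (intro mult_mono powr_mono) (auto simp: log_bounded_def)
  then show ?thesis by (simp add: norm_mult norm_of_nat_powr)
qed simp

lemma summable_norm_dirichlet:
  assumes "log_bounded a" "Re s > 1"
  shows "summable (\<lambda>n. norm (of_real (a n) * of_nat n powr (- s) :: complex))"
proof (rule summable_comparison_test'[OF summable_log_powr[OF assms(2)], of 0])
  show "norm (norm (of_real (a n) * of_nat n powr (- s) :: complex)) \<le> (1 + ln (real n)) * real n powr (- Re s)" for n
    using norm_dirichlet_term_le[OF assms(1) order_refl, of n s] by simp
qed

lemma dirichlet_sums:
  assumes "log_bounded a" "Re s > 1"
  shows "(\<lambda>n. of_real (a n) * of_nat n powr (- s)) sums dirichlet a s"
  unfolding dirichlet_def
  by (rule summable_sums[OF summable_norm_cancel[OF summable_norm_dirichlet[OF assms]]])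

lemma open_Re_gt: "open {s. Re s > c}"
  by (simp add: open_halfspace_Re_gt)

text \<open>Term-by-term differentiation: on a ball around \<open>x\<close> reaching half way to the
  line \<open>Re s = 1\<close>, a single series from \<open>summable_log_powr\<close> majorises all
  terms. The second conclusion says that the infinite sum in the first is a genuine limit.\<close>

lemma dirichlet_has_derivative:
  assumes a: "log_bounded a" and s: "Re s > 1"
  shows "(dirichlet a has_field_derivative
            (\<Sum>n. of_real (- a n * ln (real n)) * of_nat n powr (- s))) (at s)"
    and "(\<lambda>n. of_real (- a n * ln (real n)) * of_nat n powr (- s)) sums
          (\<Sum>n. of_real (- a n * ln (real n)) * of_nat n powr (- s) :: complex)"
proof -
  let ?S = "{s. Re s > 1}"
  let ?f = "\<lambda>n s. of_real (a n) * of_nat n powr (- s) :: complex"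
  let ?f' = "\<lambda>n s. of_real (- a n * ln (real n)) * of_nat n powr (- s) :: complex"
  have "\<exists>g g'. \<forall>x \<in> ?S. ((\<lambda>n. ?f n x) sums g x) \<and> ((\<lambda>n. ?f' n x) sums g' x) \<and> (g has_field_derivative g' x) (at x)"
  proof (rule series_and_derivative_comparison_local)
    show "open ?S" by (rule open_Re_gt)
    show "(?f n has_field_derivative ?f' n x) (at x)" if "x \<in> ?S" for n x
    proof (cases "n = 0")
      case False
      then have "((\<lambda>z. of_nat n powr (- z)) has_field_derivative Ln (of_nat n) * of_nat n powr (- x) * (- 1)) (at x)"
        by (intro DERIV_chain2[OF has_field_derivative_powr_right] derivative_intros) auto
      from DERIV_cmult[OF this, of "of_real (a n)"] show ?thesis using False by (simp add: mult_ac)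
    qed simp
    fix x assume x: "x \<in> ?S"
    define d where "d = (Re x - 1) / 2"
    have d: "d > 0" "Re x - d > 1" using x by (auto simp: d_def field_simps)
    have "norm (?f n y) \<le> (1 + ln (real n)) * real n powr (- (Re x - d))" if "y \<in> ball x d \<inter> ?S" for n y
    proof (rule norm_dirichlet_term_le[OF a])
      have "\<bar>Re x - Re y\<bar> \<le> dist x y" by (metis abs_Re_le_cmod dist_norm minus_complex.sel(1))
      then show "Re x - d \<le> Re y" using that by auto
    qed
    then show "\<exists>d h. 0 < d \<and> summable h \<and> (\<forall>\<^sub>F n in sequentially. \<forall>y\<in>ball x d \<inter> ?S. norm (?f n y) \<le> h n)"
      using d summable_log_powr[OF d(2)]
      by (intro exI[of _ d] exI[of _ "\<lambda>n. (1 + ln (real n)) * real n powr (- (Re x - d))"] conjI always_eventually) auto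
  qed
  then obtain g g' where g: "\<And>x. x \<in> ?S \<Longrightarrow> (\<lambda>n. ?f n x) sums g x"
    and g': "\<And>x. x \<in> ?S \<Longrightarrow> (\<lambda>n. ?f' n x) sums g' x"
    and der: "\<And>x. x \<in> ?S \<Longrightarrow> (g has_field_derivative g' x) (at x)" by blast
  have eq: "g' s = (\<Sum>n. ?f' n s)" using g'[of s] s sums_unique by blast
  have "dirichlet a x = g x" if "x \<in> ?S" for x
    unfolding dirichlet_def using g[OF that] sums_unique by metis
  then show "(dirichlet a has_field_derivative (\<Sum>n. ?f' n s)) (at s)"
    using has_field_derivative_transform_within_open[OF der open_Re_gt, of s 1 "dirichlet a"] s eq by auto
  show "(\<lambda>n. ?f' n s) sums (\<Sum>n. ?f' n s)" using g'[of s] s eq by simp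
qed

lemma holomorphic_dirichlet:
  "log_bounded a \<Longrightarrow> dirichlet a holomorphic_on {s. Re s > 1}"
  unfolding holomorphic_on_def field_differentiable_def
  using dirichlet_has_derivative(1) has_field_derivative_at_within by blast

abbreviation "zeta_sum \<equiv> dirichlet (\<lambda>_. 1)"

lemma zeta_sum_has_derivative:
  assumes "Re s > 1"
  shows "(zeta_sum has_field_derivative - dirichlet (\<lambda>n. ln (real n)) s) (at s)"
proof -
  have "(\<Sum>n. of_real (- 1 * ln (real n)) * of_nat n powr (- s) :: complex) = - dirichlet (\<lambda>n. ln (real n)) s"
    using sums_minus[OF dirichlet_sums[OF log_bounded_ln assms]] by (simp add: sums_iff)
  then show ?thesis using dirichlet_has_derivative(1)[OF log_bounded_one assms] by simp
qed

section \<open>Dirichlet convolution of \<Lambda> with 1\<close>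

text \<open>Absolute convergence permits unordered summation, which the regrouping by divisors
  relies on. Index 0 is dropped because it is not a product of positive factors.\<close>

lemma dirichlet_has_sum:
  assumes "log_bounded a" "Re s > 1"
  shows "((\<lambda>n. of_real (a n) * of_nat n powr (- s)) has_sum dirichlet a s) {0<..}"
proof -
  have "((\<lambda>n. of_real (a n) * of_nat n powr (- s)) has_sum dirichlet a s) UNIV"
    by (rule norm_summable_imp_has_sum[OF summable_norm_dirichlet dirichlet_sums]) (use assms in auto)
  then show ?thesis by (rule has_sum_cong_neutral[THEN iffD1, rotated -1]) auto
qed

text \<open>The pair \<open>(d, e)\<close> corresponds to \<open>(d * e, d)\<close>, so the double
  sum is grouped by the product of its indices.\<close>

lemma has_sum_divisors:
  fixes f :: "nat \<times> nat \<Rightarrow> 'a :: {comm_monoid_add, topological_space}"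
  shows "(f has_sum S) ({0<..} \<times> {0<..}) \<longleftrightarrow>
           ((\<lambda>(n, d). f (d, n div d)) has_sum S) (Sigma {0<..} (\<lambda>n. {d. d dvd n}))"
proof (rule has_sum_reindex_bij_witness[of _ "\<lambda>(n, d). (d, n div d)" "\<lambda>(d, e). (d * e, d)"])
  fix b :: "nat \<times> nat" assume "b \<in> Sigma {0<..} (\<lambda>n. {d. d dvd n})"
  then show "(case b of (n, d) \<Rightarrow> (d, n div d)) \<in> {0<..} \<times> {0<..}"
    by (auto intro!: Nat.gr0I simp: dvd_div_eq_0_iff)
qed (auto simp: dvd_div_eq_0_iff)

text \<open>The product of the two series collects, at each \<open>n\<close>, the sum of
  \<Lambda>(d) over the divisors of \<open>n\<close>, which is \<open>ln n\<close>.\<close>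

lemma mangoldt_times_zeta:
  assumes s: "Re s > 1"
  shows "dirichlet mangoldt s * zeta_sum s = dirichlet (\<lambda>n. ln (real n)) s"
proof -
  let ?A = "{0<..} :: nat set"
  let ?m = "\<lambda>n. of_real (mangoldt n) * of_nat n powr (- s) :: complex"
  let ?z = "\<lambda>n. of_real 1 * of_nat n powr (- s) :: complex"
  let ?f = "\<lambda>(d, e). ?m d * ?z e"
  \<comment> \<open>Absolute summability over all pairs, so that the double sum may be evaluated by
    rows and then regrouped by products.\<close>
  have summ: "?f summable_on ?A \<times> ?A"
  proof -
    have m: "(\<lambda>n. norm (?m n)) summable_on ?A" and z: "(\<lambda>n. norm (?z n)) summable_on ?A"
      using summable_norm_dirichlet[OF log_bounded_mangoldt s] summable_norm_dirichlet[OF log_bounded_one s]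
      by (metis norm_ge_zero subset_UNIV summable_nonneg_imp_summable_on summable_on_subset_banach)+
    have "(\<lambda>x. norm (?f x)) summable_on ?A \<times> ?A"
      unfolding Infinite_Sum.abs_summable_on_Sigma_iff
    proof (intro conjI ballI)
      show "(\<lambda>y. norm (?f (x, y))) summable_on ?A" for x
        using summable_on_cmult_right[OF z, of "norm (?m x)"] by (simp add: norm_mult)
      have "(\<lambda>x. norm (?m x) * infsum (\<lambda>n. norm (?z n)) ?A) summable_on ?A"
        by (rule summable_on_cmult_left[OF m])
      moreover have "infsum (\<lambda>y. norm (?f (x, y))) ?A = norm (?m x) * infsum (\<lambda>n. norm (?z n)) ?A" for x
        by (simp add: norm_mult infsum_cmult_right')
      ultimately show "(\<lambda>x. norm (infsum (\<lambda>y. norm (?f (x, y))) ?A)) summable_on ?A"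
        by (simp add: norm_mult infsum_nonneg abs_mult)
    qed
    then show ?thesis by (rule abs_summable_summable)
  qed
  have "(?f has_sum (dirichlet mangoldt s * zeta_sum s)) (?A \<times> ?A)"
  proof (rule has_sum_SigmaI[OF _ _ summ])
    show "((\<lambda>y. ?f (x, y)) has_sum ?m x * zeta_sum s) ?A" for x
      using has_sum_cmult_right[OF dirichlet_has_sum[OF log_bounded_one s], of "?m x"] by simp
    show "((\<lambda>x. ?m x * zeta_sum s) has_sum dirichlet mangoldt s * zeta_sum s) ?A"
      by (rule has_sum_cmult_left[OF dirichlet_has_sum[OF log_bounded_mangoldt s]])
  qed
  also have "?this \<longleftrightarrow> ((\<lambda>(n, d). ?m d * ?z (n div d)) has_sum (dirichlet mangoldt s * zeta_sum s))
               (Sigma ?A (\<lambda>n. {d. d dvd n}))"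
    using has_sum_divisors[of ?f] by simp
  finally have hs: "((\<lambda>(n, d). ?m d * ?z (n div d)) has_sum (dirichlet mangoldt s * zeta_sum s))
               (Sigma ?A (\<lambda>n. {d. d dvd n}))" .
  have "((\<lambda>n. of_real (ln (real n)) * of_nat n powr (- s)) has_sum (dirichlet mangoldt s * zeta_sum s)) ?A"
  proof (rule has_sum_SigmaD[OF hs])
    fix n :: nat assume n: "n \<in> ?A"
    have "(\<Sum>d | d dvd n. ?m d * ?z (n div d)) = (\<Sum>d | d dvd n. of_real (mangoldt d) * of_nat n powr (- s))"
    proof (rule sum.cong)
      fix d assume "d \<in> {d. d dvd n}"
      then have nd: "real d * real (n div d) = real n" by (metis dvd_mult_div_cancel mem_Collect_eq of_nat_mult)
      have "of_nat n powr (- s) = (of_nat d powr (- s) * of_nat (n div d) powr (- s) :: complex)"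
        by (subst powr_times_real [symmetric]) (use nd in \<open>simp_all flip: of_nat_mult\<close>)
      then show "?m d * ?z (n div d) = of_real (mangoldt d) * of_nat n powr (- s)" by simp
    qed simp
    also have "\<dots> = of_real (ln (real n)) * of_nat n powr (- s)"
      using mangoldt_sum[of n, where 'a = complex] n by (simp flip: sum_distrib_right)
    finally show "((\<lambda>d. case (n, d) of (n, d) \<Rightarrow> ?m d * ?z (n div d)) has_sum
        of_real (ln (real n)) * of_nat n powr (- s)) {d. d dvd n}"
      using n by (intro has_sum_finiteI) auto
  qed
  then show ?thesis
    using dirichlet_has_sum[OF log_bounded_ln s] has_sum_unique by blast
qed

section \<open>Zeros of the zeta function\<close>

text \<open>Summing \<open>zeta_step n s = (s - 1) * (n+1) powr (-s) - integral of (s - 1) * x powr (-s) over [n+1, n+2]\<close>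
  continues \<open>(s - 1) \<zeta>(s) = zeta1 s\<close> to \<open>Re s > 0\<close>.\<close>

definition zeta_step :: "nat \<Rightarrow> complex \<Rightarrow> complex" where
  "zeta_step n s = (s - 1) * of_nat (Suc n) powr (- s)
      - (of_nat (Suc n) powr (1 - s) - of_nat (Suc (Suc n)) powr (1 - s))"

definition zeta1 :: "complex \<Rightarrow> complex" where
  "zeta1 s = 1 + (\<Sum>n. zeta_step n s)"

text \<open>The mean value inequality is applied twice on the segment from \<open>N = n + 1\<close>
  to \<open>N + 1\<close>: first to \<open>z powr (- s)\<close>, then to \<open>?g\<close>. This
  gains a factor \<open>1 / N\<close> over the term \<open>(s - 1) * N powr (- s)\<close>, hence
  convergence for \<open>Re s > 0\<close>.\<close>

lemma norm_zeta_step_le: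
  assumes s: "Re s > 0"
  shows "norm (zeta_step n s) \<le> norm (s - 1) * norm s * real (Suc n) powr (- Re s - 1)"
proof -
  define N where "N = real (Suc n)"
  have N: "N \<ge> 1" by (simp add: N_def)
  let ?S = "closed_segment (complex_of_real N) (complex_of_real (N + 1))"
  have S: "?S = complex_of_real ` {N..N+1}"
    using N by (simp only: closed_segment_of_real closed_segment_eq_real_ivl) auto
  have conv: "convex ?S" by (rule convex_closed_segment)
  have mem: "complex_of_real N \<in> ?S" "complex_of_real (N + 1) \<in> ?S" by auto
  have nonpos: "z \<notin> \<real>\<^sub>\<le>\<^sub>0" if "z \<in> ?S" for z using that N unfolding S by auto
  have inner: "norm (of_real N powr (- s) - z powr (- s)) \<le> norm s * N powr (- Re s - 1)" if z: "z \<in> ?S" for z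
  proof -
    have "norm (of_real N powr (- s) - z powr (- s)) \<le> (norm s * N powr (- Re s - 1)) * norm (of_real N - z)"
    proof (rule field_differentiable_bound[OF conv _ _ mem(1) z])
      show "((\<lambda>z. z powr (- s)) has_field_derivative - s * w powr (- s - 1)) (at w within ?S)" if "w \<in> ?S" for w
        by (rule has_field_derivative_at_within[OF has_field_derivative_powr[OF nonpos[OF that]]])
      show "norm (- s * w powr (- s - 1)) \<le> norm s * N powr (- Re s - 1)" if w: "w \<in> ?S" for w
      proof -
        obtain x where x: "w = of_real x" "N \<le> x" using w unfolding S by auto
        have "norm (w powr (- s - 1)) = x powr (- Re s - 1)" using x N by (simp add: norm_powr_real_powr)
        also have "\<dots> \<le> N powr (- Re s - 1)" using x N s by (intro powr_mono2') auto
        finally show ?thesis by (simp add: norm_mult mult_left_mono)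
      qed
    qed
    also have "\<dots> \<le> (norm s * N powr (- Re s - 1)) * 1"
    proof (rule mult_left_mono)
      obtain x where x: "z = of_real x" "N \<le> x" "x \<le> N + 1" using z unfolding S by auto
      have "norm (of_real N - z) = \<bar>N - x\<bar>" unfolding x(1) by (metis norm_of_real of_real_diff)
      then show "norm (of_real N - z) \<le> 1" using x by linarith
    qed simp
    finally show ?thesis by simp
  qed
  \<comment> \<open>The increment of \<open>?g\<close> over the segment is
    \<open>zeta_step n s\<close>, and its derivative is \<open>s - 1\<close> times the difference
    bounded in \<open>inner\<close>.\<close>
  let ?g = "\<lambda>z. (s - 1) * of_real N powr (- s) * z + z powr (1 - s)"
  have "norm (?g (of_real (N + 1)) - ?g (of_real N))
      \<le> (norm (s - 1) * norm s * N powr (- Re s - 1)) * norm (complex_of_real (N + 1) - of_real N)"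
  proof (rule field_differentiable_bound[OF conv _ _ mem(2) mem(1)])
    show "(?g has_field_derivative (s - 1) * (of_real N powr (- s) - w powr (- s))) (at w within ?S)" if "w \<in> ?S" for w
    proof (rule has_field_derivative_at_within)
      have "(?g has_field_derivative (s - 1) * of_real N powr (- s) * 1 + (1 - s) * w powr (1 - s - 1)) (at w)"
        by (intro DERIV_add DERIV_cmult DERIV_ident has_field_derivative_powr nonpos[OF that])
      then show "(?g has_field_derivative (s - 1) * (of_real N powr (- s) - w powr (- s))) (at w)"
        by (simp add: algebra_simps)
    qed
    show "norm ((s - 1) * (of_real N powr (- s) - w powr (- s))) \<le> norm (s - 1) * norm s * N powr (- Re s - 1)"
      if "w \<in> ?S" for w
      using mult_left_mono[OF inner[OF that], of "norm (s - 1)"] by (simp add: norm_mult mult.assoc)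
  qed
  also have "?g (of_real (N + 1)) - ?g (of_real N) = zeta_step n s"
    by (simp add: zeta_step_def N_def algebra_simps)
  also have "complex_of_real (N + 1) - of_real N = 1" by simp
  finally show ?thesis by (simp add: N_def)
qed

lemma zeta_step_holomorphic: "zeta_step n holomorphic_on A"
  unfolding zeta_step_def by (intro holomorphic_intros) (auto simp del: of_nat_Suc)

lemma summable_Suc_powr: "\<sigma> > 1 \<Longrightarrow> summable (\<lambda>n. real (Suc n) powr (- \<sigma>))"
  using summable_ignore_initial_segment[of "\<lambda>n. real n powr (- \<sigma>)" 1] by (simp add: summable_real_powr_iff)

text \<open>Near \<open>x\<close> the entire functions \<open>zeta_step n\<close> are dominated by a
  multiple of \<open>real (Suc n) powr (- (d + 1))\<close> with \<open>d = Re x / 2\<close>, so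
  their series converges locally uniformly.\<close>

lemma zeta1_holomorphic: "zeta1 holomorphic_on {s. Re s > 0}"
proof -
  let ?S = "{s. Re s > 0}"
  have "\<exists>g g'. \<forall>x \<in> ?S. ((\<lambda>n. zeta_step n x) sums g x) \<and> ((\<lambda>n. deriv (zeta_step n) x) sums g' x)
          \<and> (g has_field_derivative g' x) (at x)"
  proof (rule series_and_derivative_comparison_local)
    show "open ?S" by (rule open_Re_gt)
    show "(zeta_step n has_field_derivative deriv (zeta_step n) x) (at x)" for n x
      using holomorphic_derivI[OF zeta_step_holomorphic open_UNIV] by auto
    fix x assume x: "x \<in> ?S"
    define d where "d = Re x / 2"
    have d: "d > 0" using x by (simp add: d_def)
    have "norm (zeta_step n y) \<le> (norm x + d + 1) ^ 2 * real (Suc n) powr (- (d + 1))"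
      if y: "y \<in> ball x d \<inter> ?S" for n y
    proof -
      have "\<bar>Re x - Re y\<bar> \<le> dist x y" by (metis abs_Re_le_cmod dist_norm minus_complex.sel(1))
      then have Re: "d \<le> Re y" using y by (auto simp: d_def)
      have "norm y \<le> norm x + dist x y" by (metis dist_commute dist_norm norm_triangle_sub)
      moreover have "norm (y - 1) \<le> norm y + 1" using norm_triangle_ineq4[of y 1] by simp
      ultimately have ny: "norm y \<le> norm x + d + 1" "norm (y - 1) \<le> norm x + d + 1" using y by auto
      have "norm (zeta_step n y) \<le> norm (y - 1) * norm y * real (Suc n) powr (- Re y - 1)"
        using Re d by (intro norm_zeta_step_le) auto
      also have "\<dots> \<le> ((norm x + d + 1) * (norm x + d + 1)) * real (Suc n) powr (- (d + 1))"
        using Re d ny by (intro mult_mono powr_mono) auto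
      finally show ?thesis by (simp add: power2_eq_square)
    qed
    then show "\<exists>d h. 0 < d \<and> summable h \<and> (\<forall>\<^sub>F n in sequentially. \<forall>y\<in>ball x d \<inter> ?S. norm (zeta_step n y) \<le> h n)"
      using d by (intro exI[of _ d] exI[of _ "\<lambda>n. (norm x + d + 1) ^ 2 * real (Suc n) powr (- (d + 1))"] conjI
          always_eventually allI ballI summable_mult summable_Suc_powr) auto
  qed
  then obtain g g' where g: "\<And>x. x \<in> ?S \<Longrightarrow> (\<lambda>n. zeta_step n x) sums g x"
    and der: "\<And>x. x \<in> ?S \<Longrightarrow> (g has_field_derivative g' x) (at x)" by blast
  have "g holomorphic_on ?S"
    unfolding holomorphic_on_def field_differentiable_def
    using der has_field_derivative_at_within by blast
  then have "(\<lambda>s. 1 + g s) holomorphic_on ?S" by (intro holomorphic_intros)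
  moreover have "zeta1 s = 1 + g s" if "s \<in> ?S" for s
    using g[OF that] by (simp add: zeta1_def sums_iff)
  ultimately show ?thesis using holomorphic_transform by (metis (no_types, lifting))
qed

lemma zeta1_1 [simp]: "zeta1 1 = 1"
  by (simp add: zeta1_def zeta_step_def del: of_nat_Suc)

text \<open>The integrals subtracted in \<open>zeta_step\<close> telescope to
  \<open>1 - of_nat (Suc M) powr (1 - s)\<close>, which tends to 1. This limit cancels the summand 1
  in \<open>zeta1\<close>.\<close>

lemma zeta1_eq:
  assumes s: "Re s > 1"
  shows "zeta1 s = (s - 1) * zeta_sum s"
proof -
  have "(\<lambda>n. of_nat (Suc n) powr (- s)) sums zeta_sum s"
    using dirichlet_sums[OF log_bounded_one s] sums_Suc_iff[of "\<lambda>n. of_nat n powr (- s)"] by simp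
  then have "(\<lambda>M. \<Sum>n<M. of_nat (Suc n) powr (- s)) \<longlonglongrightarrow> zeta_sum s" by (simp add: sums_def)
  moreover have "(\<lambda>M. of_nat (Suc M) powr (1 - s) :: complex) \<longlonglongrightarrow> 0"
  proof (rule tendsto_norm_zero_cancel)
    have "(\<lambda>M. real M powr (1 - Re s)) \<longlonglongrightarrow> 0" using s by real_asymp
    then show "(\<lambda>M. norm (of_nat (Suc M) powr (1 - s) :: complex)) \<longlonglongrightarrow> 0"
      using LIMSEQ_Suc[of "\<lambda>M. real M powr (1 - Re s)"] unfolding norm_of_nat_powr by simp
  qed
  ultimately have "(\<lambda>M. (s - 1) * (\<Sum>n<M. of_nat (Suc n) powr (- s)) - (1 - of_nat (Suc M) powr (1 - s)))
      \<longlonglongrightarrow> (s - 1) * zeta_sum s - (1 - 0)"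
    by (intro tendsto_intros)
  moreover have "(\<Sum>n<M. zeta_step n s) = (s - 1) * (\<Sum>n<M. of_nat (Suc n) powr (- s)) - (1 - of_nat (Suc M) powr (1 - s))" for M
    by (induction M) (simp_all add: zeta_step_def algebra_simps)
  ultimately have "(\<lambda>n. zeta_step n s) sums ((s - 1) * zeta_sum s - 1)" by (simp add: sums_def)
  then show ?thesis by (simp add: zeta1_def sums_iff)
qed

text \<open>The logarithmic derivative of \<open>zeta1\<close> in a form without division by
  \<open>zeta1 s\<close>, whose nonvanishing is still to be shown.\<close>

lemma deriv_zeta1:
  assumes s: "Re s > 1"
  shows "(s - 1) * deriv zeta1 s = zeta1 s * (1 - (s - 1) * dirichlet mangoldt s)"
proof -
  have "((\<lambda>s. (s - 1) * zeta_sum s) has_field_derivative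
        (1 - 0) * zeta_sum s + - dirichlet (\<lambda>n. ln (real n)) s * (s - 1)) (at s)"
    by (intro DERIV_mult DERIV_diff DERIV_ident DERIV_const zeta_sum_has_derivative s)
  then have "(zeta1 has_field_derivative
        (1 - 0) * zeta_sum s + - dirichlet (\<lambda>n. ln (real n)) s * (s - 1)) (at s)"
    using has_field_derivative_transform_within_open[OF _ open_Re_gt[of 1]] s zeta1_eq by (metis (no_types, lifting) mem_Collect_eq)
  then have d: "deriv zeta1 s = zeta_sum s - dirichlet mangoldt s * zeta_sum s * (s - 1)"
    by (simp add: DERIV_imp_deriv mangoldt_times_zeta[OF s])
  show ?thesis unfolding d zeta1_eq[OF s] by (simp add: algebra_simps)
qed

section \<open>Logarithmic derivatives and nonvanishing on \<open>Re s \<ge> 1\<close>\<close>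

text \<open>Here \<open>k\<close> is the order of vanishing at \<xi>: writing
  \<open>f w = (w - \<xi>)^k * g w\<close> with \<open>g\<close> nonzero near \<xi>, the quotient
  f'/f is k/(w - \<xi>) + g'/g. The point \<open>z\<close> with \<open>f z \<noteq> 0\<close> and
  connectedness exclude infinite order.\<close>

lemma logderiv_order:
  assumes f: "f holomorphic_on S" and S: "open S" "connected S" "\<xi> \<in> S"
    and nz: "z \<in> S" "f z \<noteq> 0"
  obtains k :: nat where "((\<lambda>w. (w - \<xi>) * (deriv f w / f w)) \<longlongrightarrow> of_nat k) (at \<xi>)"
    "k = 0 \<longleftrightarrow> f \<xi> \<noteq> 0" "\<forall>\<^sub>F w in at \<xi>. f w \<noteq> 0"
proof (cases "f \<xi> = 0")
  case False
  have c: "isCont f \<xi>" "isCont (deriv f) \<xi>"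
    using f holomorphic_deriv[OF f S(1)] S
    by (metis continuous_on_eq_continuous_at holomorphic_on_imp_continuous_on)+
  have "((\<lambda>w. (w - \<xi>) * (deriv f w / f w)) \<longlongrightarrow> (\<xi> - \<xi>) * (deriv f \<xi> / f \<xi>)) (at \<xi>)"
    using c False by (intro tendsto_intros) (auto simp: isCont_def)
  moreover have "\<forall>\<^sub>F w in at \<xi>. f w \<noteq> 0"
    using c(1) False by (auto simp: isCont_def intro: tendsto_imp_eventually_ne)
  ultimately show ?thesis using that[of 0] False by simp
next
  case True
  then have nonc: "\<not> f constant_on S" using nz S(3) unfolding constant_on_def by force
  obtain g r n where n: "0 < n" and r: "0 < r" "ball \<xi> r \<subseteq> S" and g: "g holomorphic_on ball \<xi> r"
    and fg: "\<And>w. w \<in> ball \<xi> r \<Longrightarrow> f w = (w - \<xi>)^n * g w"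
    and gnz: "\<And>w. w \<in> ball \<xi> r \<Longrightarrow> g w \<noteq> 0"
    using holomorphic_factor_zero_nonconstant[OF f S True nonc] by metis
  have c: "isCont g \<xi>" "isCont (deriv g) \<xi>"
    using g holomorphic_deriv[OF g] r
    by (metis centre_in_ball continuous_on_eq_continuous_at holomorphic_on_imp_continuous_on open_ball)+
  have ev: "\<forall>\<^sub>F w in at \<xi>. w \<in> ball \<xi> r \<and> w \<noteq> \<xi>"
    using r eventually_at_in_open[of "ball \<xi> r" \<xi>] by auto
  have eq: "of_nat n + (w - \<xi>) * (deriv g w / g w) = (w - \<xi>) * (deriv f w / f w)" if w: "w \<in> ball \<xi> r" "w \<noteq> \<xi>" for w
  proof -
    have "((\<lambda>w. w - \<xi>) has_field_derivative 1) (at w)" by (auto intro!: derivative_eq_intros)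
    from DERIV_mult[OF DERIV_power[OF this, of n] holomorphic_derivI[OF g open_ball w(1)]]
    have "((\<lambda>w. (w - \<xi>)^n * g w) has_field_derivative
        (of_nat n * (1 * (w - \<xi>)^(n - Suc 0))) * g w + deriv g w * (w - \<xi>)^n) (at w)" .
    then have "(f has_field_derivative
        (of_nat n * (1 * (w - \<xi>)^(n - Suc 0))) * g w + deriv g w * (w - \<xi>)^n) (at w)"
      using has_field_derivative_transform_within_open[OF _ open_ball w(1)] fg by (metis (no_types, lifting))
    then have d: "deriv f w = of_nat n * (w - \<xi>)^(n - 1) * g w + deriv g w * (w - \<xi>)^n"
      by (simp add: DERIV_imp_deriv)
    have p: "(w - \<xi>) * (w - \<xi>)^(n - 1) = (w - \<xi>)^n" using n by (metis power_minus_mult mult.commute)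
    have "(w - \<xi>) * deriv f w = of_nat n * ((w - \<xi>) * (w - \<xi>)^(n - 1)) * g w + (w - \<xi>) * deriv g w * (w - \<xi>)^n"
      unfolding d by (simp add: algebra_simps)
    also have "\<dots> = (of_nat n + (w - \<xi>) * (deriv g w / g w)) * f w"
      unfolding p fg[OF w(1)] using gnz[OF w(1)] by (simp add: field_simps)
    finally show ?thesis using w gnz[OF w(1)] fg[OF w(1)] by simp
  qed
  have "((\<lambda>w. of_nat n + (w - \<xi>) * (deriv g w / g w)) \<longlongrightarrow> of_nat n + (\<xi> - \<xi>) * (deriv g \<xi> / g \<xi>)) (at \<xi>)"
    using c gnz[of \<xi>] r by (intro tendsto_intros) (auto simp: isCont_def)
  moreover have "\<forall>\<^sub>F w in at \<xi>. of_nat n + (w - \<xi>) * (deriv g w / g w) = (w - \<xi>) * (deriv f w / f w)"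
    using ev by eventually_elim (use eq in blast)
  ultimately have "((\<lambda>w. (w - \<xi>) * (deriv f w / f w)) \<longlongrightarrow> of_nat n) (at \<xi>)"
    using Lim_transform_eventually by fastforce
  moreover have "\<forall>\<^sub>F w in at \<xi>. f w \<noteq> 0" using ev by eventually_elim (use fg gnz in auto)
  ultimately show ?thesis using that[of n] True n by simp
qed

lemma mangoldt_logderiv:
  assumes "Re s > 1" "zeta1 s \<noteq> 0"
  shows "dirichlet mangoldt s = 1 / (s - 1) - deriv zeta1 s / zeta1 s"
proof -
  have "s \<noteq> 1" using assms by auto
  then show ?thesis using deriv_zeta1[OF assms(1)] assms(2) by (simp add: field_simps)
qed

text \<open>Each coefficient \<Lambda>(n) is nonnegative, and it is multiplied by
  \<open>3 + 4 * cos x + cos (2 * x) = 2 * (1 + cos x)\<^sup>2\<close> with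
  \<open>x = t * ln n\<close>.\<close>

lemma three_four_one:
  fixes \<sigma> t :: real
  assumes "\<sigma> > 1"
  shows "0 \<le> 3 * Re (dirichlet mangoldt (of_real \<sigma>)) + 4 * Re (dirichlet mangoldt (Complex \<sigma> t))
            + Re (dirichlet mangoldt (Complex \<sigma> (2 * t)))"
proof -
  let ?c = "\<lambda>t n. mangoldt n * (real n powr (- \<sigma>) * cos (t * ln (real n)))"
  have sums: "(\<lambda>n. ?c t n) sums Re (dirichlet mangoldt (Complex \<sigma> t))" for t
  proof -
    have R: "Re (of_nat n powr (- Complex \<sigma> t)) = real n powr (- \<sigma>) * cos (t * ln (real n))" for n
    proof (cases "n = 0")
      case False
      then show ?thesis by (simp add: powr_def Re_exp)
    qed simp
    have "Re (of_real (mangoldt n) * of_nat n powr (- Complex \<sigma> t)) = ?c t n" for n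
      by (simp only: R Re_complex_of_real Im_complex_of_real times_complex.sel mult_zero_left diff_zero)
    moreover have "(\<lambda>n. Re (of_real (mangoldt n) * of_nat n powr (- Complex \<sigma> t))) sums Re (dirichlet mangoldt (Complex \<sigma> t))"
      using assms by (intro sums_Re dirichlet_sums log_bounded_mangoldt) simp
    ultimately show ?thesis by (simp only:)
  qed
  have "(\<lambda>n. 3 * ?c 0 n + 4 * ?c t n + ?c (2 * t) n) sums
      (3 * Re (dirichlet mangoldt (Complex \<sigma> 0)) + 4 * Re (dirichlet mangoldt (Complex \<sigma> t))
            + Re (dirichlet mangoldt (Complex \<sigma> (2 * t))))"
    by (intro sums_add sums_mult sums)
  moreover have "0 \<le> 3 * ?c 0 n + 4 * ?c t n + ?c (2 * t) n" for n
  proof -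
    let ?x = "t * ln (real n)"
    have "3 * ?c 0 n + 4 * ?c t n + ?c (2 * t) n
        = mangoldt n * real n powr (- \<sigma>) * (3 + 4 * cos ?x + cos (2 * ?x))"
      by (simp add: algebra_simps)
    also have "3 + 4 * cos ?x + cos (2 * ?x) = 2 * (1 + cos ?x)\<^sup>2"
      by (simp only: cos_double_cos) (simp add: power2_eq_square algebra_simps)
    finally show ?thesis by (simp add: mangoldt_nonneg)
  qed
  ultimately show ?thesis
    by (metis (mono_tags, lifting) complex_of_real_def sums_le sums_zero)
qed

text \<open>If \<open>zeta1\<close> vanishes to order \<open>k\<close> at \<open>\<xi>\<close>, then \<open>\<delta> * dirichlet mangoldt (\<xi> + \<delta>)\<close> tends to \<open>-k\<close>,
  plus \<open>1\<close> for the pole at \<open>\<xi> = 1\<close>. On the line \<open>Re s = 1\<close> this turns \<open>three_four_one\<close> into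
  \<open>3 - 4 * k - k' \<ge> 0\<close>; to the right of it the limit is \<open>0\<close>.\<close>

lemma zeta1_nonzero:
  assumes "Re s \<ge> 1"
  shows "zeta1 s \<noteq> 0"
proof
  assume z: "zeta1 s = 0"
  let ?S = "{s. Re s > 0}"
  have conn: "connected ?S" by (intro convex_connected convex_halfspace_Re_gt)
  have ord: "\<exists>k::nat. ((\<lambda>w. (w - \<xi>) * (deriv zeta1 w / zeta1 w)) \<longlongrightarrow> of_nat k) (at \<xi>)
      \<and> (k = 0 \<longleftrightarrow> zeta1 \<xi> \<noteq> 0) \<and> (\<forall>\<^sub>F w in at \<xi>. zeta1 w \<noteq> 0)" if "Re \<xi> > 0" for \<xi>
    by (rule logderiv_order[OF zeta1_holomorphic open_Re_gt conn, of \<xi> 1]) (use that in auto)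
  \<comment> \<open>Points are approached horizontally from the right, which stays inside
    \<open>Re s > 1\<close>, where \<open>mangoldt_logderiv\<close> applies.\<close>
  have at_right: "filterlim (\<lambda>\<delta>. \<xi> + complex_of_real \<delta>) (at \<xi>) (at_right 0)" for \<xi>
  proof (rule filterlim_atI)
    show "((\<lambda>\<delta>. \<xi> + complex_of_real \<delta>) \<longlongrightarrow> \<xi>) (at_right 0)"
      by (rule tendsto_eq_intros refl | simp)+
    show "\<forall>\<^sub>F \<delta> in at_right 0. \<xi> + complex_of_real \<delta> \<noteq> \<xi>"
      using eventually_at_right_less[of 0] by eventually_elim auto
  qed
  have lim: "((\<lambda>\<delta>. of_real \<delta> * dirichlet mangoldt (\<xi> + of_real \<delta>)) \<longlongrightarrow> (if \<xi> = 1 then 1 else 0) - of_nat k) (at_right 0)"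
    if \<xi>: "Re \<xi> \<ge> 1" and k: "((\<lambda>w. (w - \<xi>) * (deriv zeta1 w / zeta1 w)) \<longlongrightarrow> of_nat k) (at \<xi>)"
      "\<forall>\<^sub>F w in at \<xi>. zeta1 w \<noteq> 0" for \<xi> :: complex and k :: nat
  proof -
    have "((\<lambda>\<delta>. of_real \<delta> / (\<xi> + of_real \<delta> - 1)) \<longlongrightarrow> (if \<xi> = 1 then 1 else 0)) (at_right 0)"
    proof (cases "\<xi> = 1")
      case True
      have "\<forall>\<^sub>F \<delta> in at_right 0. 1 = of_real \<delta> / (\<xi> + of_real \<delta> - 1)"
        using eventually_at_right_less[of 0] by eventually_elim (use True in auto)
      then have "((\<lambda>\<delta>. of_real \<delta> / (\<xi> + of_real \<delta> - 1)) \<longlongrightarrow> 1) (at_right 0)"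
        by (rule Lim_transform_eventually[OF tendsto_const])
      then show ?thesis using True by simp
    next
      case False
      have "((\<lambda>\<delta>. of_real \<delta> / (\<xi> + of_real \<delta> - 1)) \<longlongrightarrow> of_real 0 / (\<xi> + of_real 0 - 1)) (at_right 0)"
        using False by (intro tendsto_intros) auto
      then show ?thesis using False by simp
    qed
    from tendsto_diff[OF this filterlim_compose[OF k(1) at_right[of \<xi>]]]
    have "((\<lambda>\<delta>. of_real \<delta> / (\<xi> + of_real \<delta> - 1) - of_real \<delta> * (deriv zeta1 (\<xi> + of_real \<delta>) / zeta1 (\<xi> + of_real \<delta>)))
        \<longlongrightarrow> (if \<xi> = 1 then 1 else 0) - of_nat k) (at_right 0)" by simp
    moreover have "\<forall>\<^sub>F \<delta> in at_right 0. of_real \<delta> / (\<xi> + of_real \<delta> - 1) - of_real \<delta> * (deriv zeta1 (\<xi> + of_real \<delta>) / zeta1 (\<xi> + of_real \<delta>))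
        = of_real \<delta> * dirichlet mangoldt (\<xi> + of_real \<delta>)"
      using eventually_at_right_less[of 0] eventually_compose_filterlim[OF k(2) at_right]
    proof eventually_elim
      case (elim \<delta>)
      then show ?case using \<xi> by (subst mangoldt_logderiv) (auto simp: algebra_simps)
    qed
    ultimately show ?thesis by (rule Lim_transform_eventually)
  qed
  obtain k :: nat where k: "((\<lambda>w. (w - s) * (deriv zeta1 w / zeta1 w)) \<longlongrightarrow> of_nat k) (at s)"
    "\<forall>\<^sub>F w in at s. zeta1 w \<noteq> 0" "k \<noteq> 0"
    using ord[of s] assms z by auto
  have s1: "s \<noteq> 1" using z by auto
  have limk: "((\<lambda>\<delta>. of_real \<delta> * dirichlet mangoldt (s + of_real \<delta>)) \<longlongrightarrow> - of_nat k) (at_right 0)"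
    using lim[OF assms k(1,2)] s1 by simp
  show False
  proof (cases "Re s > 1")
    case True
    have "isCont (dirichlet mangoldt) s"
      using True holomorphic_on_imp_continuous_on[OF holomorphic_dirichlet[OF log_bounded_mangoldt]] open_Re_gt
      by (metis continuous_on_eq_continuous_at mem_Collect_eq)
    then have "((\<lambda>\<delta>. dirichlet mangoldt (s + of_real \<delta>)) \<longlongrightarrow> dirichlet mangoldt s) (at_right 0)"
      using filterlim_compose[OF _ at_right[of s]] by (auto simp: isCont_def)
    then have "((\<lambda>\<delta>. of_real \<delta> * dirichlet mangoldt (s + of_real \<delta>)) \<longlongrightarrow> of_real 0 * dirichlet mangoldt s) (at_right 0)"
      by (intro tendsto_intros)
    from tendsto_unique[OF _ this limk] show False using k(3) by (simp add: trivial_limit_at_right_real)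
  next
    case False
    then have Re: "Re s = 1" using assms by simp
    define t where "t = Im s"
    have s: "s = Complex 1 t" using Re by (simp add: t_def complex_eq_iff)
    have t: "t \<noteq> 0" using s1 s by (auto simp: complex_eq_iff)
    \<comment> \<open>Since \<open>zeta1 1 = 1\<close>, the order at 1 is 0 and the limit there is
      exactly 1, from the pole. The other two points avoid the pole because
      \<open>t \<noteq> 0\<close>.\<close>
    obtain k1 :: nat where k1: "((\<lambda>w. (w - 1) * (deriv zeta1 w / zeta1 w)) \<longlongrightarrow> of_nat k1) (at 1)"
      "\<forall>\<^sub>F w in at 1. zeta1 w \<noteq> 0" "k1 = 0" using ord[of 1] by auto
    obtain k2 :: nat where k2: "((\<lambda>w. (w - Complex 1 (2 * t)) * (deriv zeta1 w / zeta1 w)) \<longlongrightarrow> of_nat k2) (at (Complex 1 (2 * t)))"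
      "\<forall>\<^sub>F w in at (Complex 1 (2 * t)). zeta1 w \<noteq> 0" using ord[of "Complex 1 (2 * t)"] by auto
    have ne: "Complex 1 (2 * t) \<noteq> 1" using t by (auto simp: complex_eq_iff)
    let ?L = "dirichlet mangoldt"
    have "((\<lambda>\<delta>. 3 * Re (of_real \<delta> * ?L (1 + of_real \<delta>)) + 4 * Re (of_real \<delta> * ?L (s + of_real \<delta>))
            + Re (of_real \<delta> * ?L (Complex 1 (2 * t) + of_real \<delta>))) \<longlongrightarrow>
          3 * Re 1 + 4 * Re (- of_nat k) + Re (0 - of_nat k2)) (at_right 0)"
      using lim[OF _ k1(1,2)] lim[OF _ k2] ne k1(3) limk by (intro tendsto_intros) auto
    moreover have "\<forall>\<^sub>F \<delta> in at_right 0. 0 \<le> 3 * Re (of_real \<delta> * ?L (1 + of_real \<delta>)) + 4 * Re (of_real \<delta> * ?L (s + of_real \<delta>))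
            + Re (of_real \<delta> * ?L (Complex 1 (2 * t) + of_real \<delta>))"
      using eventually_at_right_less[of 0]
    proof eventually_elim
      case (elim \<delta>)
      have "0 \<le> \<delta> * (3 * Re (?L (of_real (1 + \<delta>))) + 4 * Re (?L (Complex (1 + \<delta>) t)) + Re (?L (Complex (1 + \<delta>) (2 * t))))"
        using three_four_one[of "1 + \<delta>" t] elim by simp
      moreover have "s + of_real \<delta> = Complex (1 + \<delta>) t" "Complex 1 (2 * t) + of_real \<delta> = Complex (1 + \<delta>) (2 * t)"
        by (auto simp: s complex_eq_iff)
      ultimately show ?case by (simp add: algebra_simps)
    qed
    ultimately have "0 \<le> 3 * Re 1 + 4 * Re (- of_nat k) + Re (0 - of_nat k2)"
      by (intro tendsto_lowerbound) (auto simp: trivial_limit_at_right_real)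
    then show False using k(3) by (simp)
  qed
qed

section \<open>Fejer kernels\<close>

text \<open>This is \<open>- \<zeta>'/\<zeta> - \<zeta>\<close>, whose poles at \<open>s = 1\<close> cancel.\<close>

definition mangoldt_remainder :: "complex \<Rightarrow> complex" where
  "mangoldt_remainder s = - (deriv zeta1 s / zeta1 s)
      - (if s = 1 then deriv zeta1 1 else (zeta1 s - zeta1 1) / (s - 1))"

text \<open>By \<open>zeta1_nonzero\<close>, the open set where \<open>zeta1\<close> is nonzero
  contains the closed half-plane. The difference quotient of \<open>zeta1\<close> at 1 has a
  removable singularity, filled in by the derivative.\<close>

lemma mangoldt_remainder_holomorphic:
  obtains S where "open S" "{s. Re s \<ge> 1} \<subseteq> S" "mangoldt_remainder holomorphic_on S"
proof -
  define S where "S = {s. Re s > 0} \<inter> zeta1 -` (- {0})"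
  have cont: "continuous_on {s. Re s > 0} zeta1"
    by (rule holomorphic_on_imp_continuous_on[OF zeta1_holomorphic])
  have S: "open S"
    unfolding S_def by (rule continuous_open_preimage[OF cont open_Re_gt]) auto
  have hol: "zeta1 holomorphic_on S"
    by (rule holomorphic_on_subset[OF zeta1_holomorphic]) (auto simp: S_def)
  have "(\<lambda>s. - (deriv zeta1 s / zeta1 s) - (if s = 1 then deriv zeta1 1 else (zeta1 s - zeta1 1) / (s - 1))) holomorphic_on S"
    by (intro holomorphic_intros pole_lemma_open hol holomorphic_deriv S) (auto simp: S_def)
  then have "mangoldt_remainder holomorphic_on S"
    by (rule holomorphic_transform) (simp add: mangoldt_remainder_def)
  moreover have "{s. Re s \<ge> 1} \<subseteq> S"
    using zeta1_nonzero by (force simp: S_def)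
  ultimately show ?thesis using that[OF S] by blast
qed

text \<open>Both series have a simple pole with residue 1 at \<open>s = 1\<close>. As
  \<open>zeta1 1 = 1\<close>, the two polar terms combine into minus the difference quotient of
  \<open>zeta1\<close>.\<close>

lemma mangoldt_remainder_eq:
  assumes s: "Re s > 1"
  shows "mangoldt_remainder s = dirichlet (\<lambda>n. mangoldt n - 1) s"
proof -
  have s1: "s \<noteq> 1" using s by auto
  have nz: "zeta1 s \<noteq> 0" using zeta1_nonzero s by simp
  have "(\<lambda>n. of_real (mangoldt n) * of_nat n powr (- s) - of_real 1 * of_nat n powr (- s)) sums
      (dirichlet mangoldt s - zeta_sum s)"
    by (intro sums_diff dirichlet_sums log_bounded_mangoldt log_bounded_one s)
  then have "dirichlet (\<lambda>n. mangoldt n - 1) s = dirichlet mangoldt s - zeta_sum s"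
    unfolding dirichlet_def[of "\<lambda>n. mangoldt n - 1"] by (simp add: sums_iff algebra_simps)
  also have "\<dots> = 1 / (s - 1) - deriv zeta1 s / zeta1 s - zeta1 s / (s - 1)"
    using mangoldt_logderiv[OF s nz] zeta1_eq[OF s] s1 by simp
  also have "\<dots> = mangoldt_remainder s"
    using s1 by (simp add: mangoldt_remainder_def diff_divide_distrib)
  finally show ?thesis by simp
qed

section \<open>Kernel estimates\<close>

text \<open>The cosine transform of the triangle \<open>1 - t / l\<close> on \<open>{0..l}\<close>,
  as \<open>fejer_has_integral\<close> shows; the value at 0 is the continuous extension.\<close>

definition fejer :: "real \<Rightarrow> real \<Rightarrow> real" where
  "fejer l u = (if u = 0 then l / 2 else (1 - cos (l * u)) / (l * u\<^sup>2))"

lemma fejer_has_integral: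
  assumes l: "l > 0"
  shows "((\<lambda>t. (1 - t / l) * cos (t * u)) has_integral fejer l u) {0..l}"
proof (cases "u = 0")
  case True
  let ?F = "\<lambda>t. t - t\<^sup>2 / (2 * l)"
  have "((\<lambda>t. (1 - t / l) * cos (t * u)) has_integral ?F l - ?F 0) {0..l}"
  proof (rule fundamental_theorem_of_calculus)
    show "(?F has_vector_derivative (1 - t / l) * cos (t * u)) (at t within {0..l})" for t
      unfolding has_real_derivative_iff_has_vector_derivative[symmetric]
      using True l by (auto intro!: derivative_eq_intros simp: field_simps)
  qed (use l in simp)
  then show ?thesis using True l by (simp add: fejer_def power2_eq_square)
next
  case False
  let ?F = "\<lambda>t. (1 - t / l) * sin (t * u) / u - cos (t * u) / (l * u\<^sup>2)"
  have "((\<lambda>t. (1 - t / l) * cos (t * u)) has_integral ?F l - ?F 0) {0..l}"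
  proof (rule fundamental_theorem_of_calculus)
    show "(?F has_vector_derivative (1 - t / l) * cos (t * u)) (at t within {0..l})" for t
      unfolding has_real_derivative_iff_has_vector_derivative[symmetric]
      using False l by (auto intro!: derivative_eq_intros simp: field_simps power2_eq_square)
  qed (use l in simp)
  then show ?thesis using False l by (simp add: fejer_def diff_divide_distrib)
qed

lemma fejer_nonneg: "l > 0 \<Longrightarrow> 0 \<le> fejer l u"
  by (auto simp: fejer_def)

lemma fejer_eq_sin: "l > 0 \<Longrightarrow> u \<noteq> 0 \<Longrightarrow> fejer l u = 2 * (sin (l * u / 2))\<^sup>2 / (l * u\<^sup>2)"
  using cos_double_sin[of "l * u / 2"] by (simp add: fejer_def)

lemma fejer_le:
  assumes l: "l > 0"
  shows "fejer l u \<le> l / 2"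
proof (cases "u = 0")
  case False
  have "(sin (l * u / 2))\<^sup>2 \<le> (l * u / 2)\<^sup>2"
    by (rule abs_le_square_iff[THEN iffD1, OF abs_sin_x_le_abs_x])
  then have "fejer l u \<le> 2 * (l * u / 2)\<^sup>2 / (l * u\<^sup>2)"
    unfolding fejer_eq_sin[OF l False] using l by (intro divide_right_mono) auto
  also have "\<dots> = l / 2" using False l by (simp add: field_simps power2_eq_square)
  finally show ?thesis .
qed (simp add: fejer_def)

lemma fejer_mult_square_le:
  assumes "l > 0"
  shows "fejer l u * u\<^sup>2 \<le> 2 / l"
proof (cases "u = 0")
  case False
  have "(1 - cos (l * u)) / l \<le> 2 / l"
    using assms cos_ge_minus_one[of "l * u"] by (intro divide_right_mono) linarith+
  then show ?thesis using False by (simp add: fejer_def)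
qed (use assms in simp)

text \<open>With \<open>v = l * \<bar>u\<bar> / 2 \<le> 1 / 2 < pi / 3\<close>, the cosine is at
  least 1/2 on \<open>{0..v}\<close>, so \<open>sin v \<ge> v / 2\<close>.\<close>

lemma fejer_ge:
  assumes l: "l > 0" and u: "\<bar>l * u\<bar> \<le> 1"
  shows "l / 8 \<le> fejer l u"
proof (cases "u = 0")
  case False
  define v where "v = l * \<bar>u\<bar> / 2"
  have v: "0 < v" "v \<le> 1 / 2" using l u False by (auto simp: v_def abs_mult)
  obtain z where z: "0 < z" "z < v" "sin v - sin 0 = (v - 0) * cos z"
    using MVT2[of 0 v sin cos] v by (auto intro: derivative_eq_intros)
  have "cos (pi / 3) \<le> cos z" using z v pi_gt3 by (intro cos_monotone_0_pi_le) auto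
  then have "v * (1 / 2) \<le> v * cos z" using v by (intro mult_left_mono) (auto simp: cos_60)
  then have "(v / 2)\<^sup>2 \<le> (sin v)\<^sup>2" using z v by (intro power_mono) auto
  also have "(sin v)\<^sup>2 = (sin (l * u / 2))\<^sup>2" by (cases "u \<ge> 0") (auto simp: v_def)
  finally have "(l * u / 4)\<^sup>2 \<le> (sin (l * u / 2))\<^sup>2" by (simp add: v_def power_mult_distrib power_divide)
  then have "2 * (l * u / 4)\<^sup>2 / (l * u\<^sup>2) \<le> fejer l u"
    unfolding fejer_eq_sin[OF l False] using l False by (intro divide_right_mono) auto
  moreover have "2 * (l * u / 4)\<^sup>2 / (l * u\<^sup>2) = l / 8" using l False by (simp add: field_simps power2_eq_square)
  ultimately show ?thesis by simp
qed (use l in \<open>simp add: fejer_def\<close>)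

text \<open>The bounds on \<open>fejer l u\<close> and on \<open>fejer l u * u\<^sup>2\<close> are
  added. The weight \<open>1 / (1 + u\<^sup>2)\<close> is convenient because it is the derivative of
  \<open>arctan\<close>.\<close>

lemma fejer_le_lorentz:
  assumes l: "l > 0"
  shows "fejer l u \<le> (l / 2 + 2 / l) / (1 + u\<^sup>2)"
proof -
  have "fejer l u * (1 + u\<^sup>2) \<le> l / 2 + 2 / l"
    using fejer_le[OF l, of u] fejer_mult_square_le[OF l, of u] by (simp add: algebra_simps)
  moreover have "1 + u\<^sup>2 > 0" by (simp add: add_pos_nonneg)
  ultimately show ?thesis by (simp add: pos_le_divide_eq)
qed

section \<open>The kernel integral up to the line \<open>Re s = 1\<close>\<close>

text \<open>The factor \<open>cis (t * y)\<close> centres the kernel at \<open>ln n = y\<close>, and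
  \<delta> is the distance from the line \<open>Re s = 1\<close>. At \<open>\<delta> = 0\<close> the
  integrand is given by the holomorphic continuation.\<close>

definition fejer_remainder :: "real \<Rightarrow> real \<Rightarrow> real \<Rightarrow> real" where
  "fejer_remainder l y \<delta> =
     integral {0..l} (\<lambda>t. Re (of_real (1 - t / l) * cis (t * y) * mangoldt_remainder (Complex (1 + \<delta>) t)))"

lemma Re_dirichlet_kernel:
  "Re (of_real c * cis (t * y) * (of_real a * of_nat n powr (- Complex \<sigma> t)))
     = a * real n powr (- \<sigma>) * (c * cos (t * (y - ln (real n))))"
proof (cases "n = 0")
  case False
  have "of_nat n powr (- Complex \<sigma> t) = of_real (real n powr (- \<sigma>)) * cis (- (t * ln (real n)))"
    using False by (simp add: powr_def complex_eq_iff Re_exp Im_exp)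
  then have "of_real c * cis (t * y) * (of_real a * of_nat n powr (- Complex \<sigma> t))
      = of_real (a * real n powr (- \<sigma>) * c) * (cis (t * y) * cis (- (t * ln (real n))))"
    by (simp add: mult_ac)
  also have "cis (t * y) * cis (- (t * ln (real n))) = cis (t * (y - ln (real n)))"
    by (simp only: cis_mult) (simp add: algebra_simps)
  finally show ?thesis
    by (simp only: times_complex.sel Re_complex_of_real Im_complex_of_real cis.sel mult_zero_left diff_zero mult.assoc)
qed simp

text \<open>For \<open>\<delta> > 0\<close> the Weierstrass test allows the series to be integrated
  term by term over \<open>{0..l}\<close>, and each term integrates to a kernel value at
  \<open>y - ln n\<close>.\<close>

lemma fejer_sum:
  assumes l: "l > 0" and \<delta>: "\<delta> > 0"
  shows "(\<lambda>n. (mangoldt n - 1) * real n powr (- (1 + \<delta>)) * fejer l (y - ln (real n))) sums fejer_remainder l y \<delta>"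
proof -
  let ?a = "\<lambda>n. mangoldt n - 1 :: real"
  let ?f = "\<lambda>n t. ?a n * real n powr (- (1 + \<delta>)) * ((1 - t / l) * cos (t * (y - ln (real n))))"
  let ?g = "\<lambda>t. Re (of_real (1 - t / l) * cis (t * y) * mangoldt_remainder (Complex (1 + \<delta>) t))"
  have "uniform_limit {0..l} (\<lambda>N t. \<Sum>n<N. ?f n t) (\<lambda>t. suminf (\<lambda>n. ?f n t)) sequentially"
  proof (rule Weierstrass_m_test)
    show "summable (\<lambda>n. (1 + ln (real n)) * real n powr (- (1 + \<delta>)))"
      using \<delta> by (intro summable_log_powr) simp
    fix n t assume t: "t \<in> {0..l}"
    have "\<bar>(1 - t / l) * cos (t * (y - ln (real n)))\<bar> \<le> 1 * 1"
      unfolding abs_mult using t l by (intro mult_mono) (auto simp: field_simps)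
    then have "norm (?f n t) \<le> \<bar>?a n\<bar> * real n powr (- (1 + \<delta>)) * 1"
      unfolding real_norm_def abs_mult by (intro mult_mono) auto
    also have "\<dots> \<le> (1 + ln (real n)) * real n powr (- (1 + \<delta>))"
      using norm_dirichlet_term_le[OF log_bounded_mangoldt_diff, of "1 + \<delta>" "of_real (1 + \<delta>)" n]
      unfolding norm_mult norm_of_nat_powr norm_of_real by simp
    finally show "norm (?f n t) \<le> (1 + ln (real n)) * real n powr (- (1 + \<delta>))" .
  qed
  moreover have "suminf (\<lambda>n. ?f n t) = ?g t" for t
  proof -
    have "(\<lambda>n. Re (of_real (1 - t / l) * cis (t * y) * (of_real (?a n) * of_nat n powr (- Complex (1 + \<delta>) t)))) sums
        Re (of_real (1 - t / l) * cis (t * y) * dirichlet ?a (Complex (1 + \<delta>) t))"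
      using \<delta> by (intro sums_Re sums_mult dirichlet_sums log_bounded_mangoldt_diff) simp
    then show ?thesis using \<delta> by (simp only: Re_dirichlet_kernel mangoldt_remainder_eq complex.sel sums_iff)
  qed
  ultimately have ul: "uniform_limit {0..l} (\<lambda>N t. \<Sum>n<N. ?f n t) ?g sequentially" by simp
  have cont: "continuous_on {0..l} (\<lambda>t. \<Sum>n<N. ?f n t)" for N
    using l by (intro continuous_intros) auto
  obtain I J where I: "\<And>N. ((\<lambda>t. \<Sum>n<N. ?f n t) has_integral I N) {0..l}"
    and J: "(?g has_integral J) {0..l}" and lim: "I \<longlonglongrightarrow> J"
    using uniform_limit_integral[OF ul cont trivial_limit_sequentially] by blast
  have "((\<lambda>t. \<Sum>n<N. ?f n t) has_integral (\<Sum>n<N. ?a n * real n powr (- (1 + \<delta>)) * fejer l (y - ln (real n)))) {0..l}" for N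
    by (intro has_integral_sum has_integral_mult_right fejer_has_integral l) auto
  then have "I = (\<lambda>N. \<Sum>n<N. ?a n * real n powr (- (1 + \<delta>)) * fejer l (y - ln (real n)))"
    using I has_integral_unique by blast
  moreover have "J = fejer_remainder l y \<delta>"
    unfolding fejer_remainder_def using J by (simp add: integral_unique)
  ultimately show ?thesis using lim by (simp add: sums_def)
qed

lemma continuous_on_mangoldt_remainder:
  assumes "continuous_on A g" "\<And>x. x \<in> A \<Longrightarrow> Re (g x) \<ge> 1"
  shows "continuous_on A (\<lambda>x. mangoldt_remainder (g x))"
proof -
  obtain S where S: "{s. Re s \<ge> 1} \<subseteq> S" "mangoldt_remainder holomorphic_on S"
    using mangoldt_remainder_holomorphic by blast
  show ?thesis
    by (rule continuous_on_compose2[OF holomorphic_on_imp_continuous_on[OF S(2)] assms(1)])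
       (use S(1) assms(2) in auto)
qed

lemma continuous_on_Complex [continuous_intros]:
  "continuous_on A f \<Longrightarrow> continuous_on A g \<Longrightarrow> continuous_on A (\<lambda>x. Complex (f x) (g x))"
proof -
  have "(\<lambda>x. Complex (f x) (g x)) = (\<lambda>x. of_real (f x) + \<i> * of_real (g x))"
    by (simp add: complex_eq_iff fun_eq_iff)
  then show "continuous_on A f \<Longrightarrow> continuous_on A g \<Longrightarrow> continuous_on A (\<lambda>x. Complex (f x) (g x))"
    by (simp only:) (intro continuous_intros)
qed

lemma fejer_remainder_tendsto:
  assumes l: "l > 0"
  shows "(fejer_remainder l y \<longlongrightarrow> fejer_remainder l y 0) (at_right 0)"
proof -
  have "continuous_on {0..1::real} (\<lambda>\<delta>. integral (cbox 0 l)
      (\<lambda>t. Re (of_real (1 - t / l) * cis (t * y) * mangoldt_remainder (Complex (1 + \<delta>) t))))"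
  proof (rule integral_continuous_on_param)
    show "continuous_on ({0..1} \<times> cbox 0 l) (\<lambda>(\<delta>, t). Re (of_real (1 - t / l) * cis (t * y) * mangoldt_remainder (Complex (1 + \<delta>) t)))"
      using l unfolding case_prod_unfold
      by (intro continuous_intros continuous_on_mangoldt_remainder) auto
  qed
  then have "continuous_on {0..1} (fejer_remainder l y)"
    unfolding fejer_remainder_def by (simp add: cbox_interval)
  then have "(fejer_remainder l y \<longlongrightarrow> fejer_remainder l y 0) (at 0 within {0..1})"
    by (simp add: continuous_on_def)
  then show ?thesis by (simp add: at_within_Icc_at_right)
qed

text \<open>For continuously differentiable functions one integration by parts suffices, and it
  bounds the integral by \<open>C / y\<close>.\<close>

lemma riemann_lebesgue:
  fixes \<phi> :: "real \<Rightarrow> complex"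
  assumes ab: "a \<le> b"
    and \<phi>: "\<And>t. t \<in> {a..b} \<Longrightarrow> (\<phi> has_vector_derivative \<phi>' t) (at t within {a..b})"
    and \<phi>': "continuous_on {a..b} \<phi>'"
  shows "((\<lambda>y. integral {a..b} (\<lambda>t. cis (t * y) * \<phi> t)) \<longlongrightarrow> 0) at_top"
proof -
  have c\<phi>: "continuous_on {a..b} \<phi>"
    using \<phi> by (meson continuous_on_vector_derivative)
  obtain B where B: "\<And>t. t \<in> {a..b} \<Longrightarrow> norm (\<phi>' t) \<le> B"
    using compact_imp_bounded[OF compact_continuous_image[OF \<phi>' compact_Icc]] unfolding bounded_iff by blast
  define C where "C = norm (\<phi> b) + norm (\<phi> a) + B * (b - a)"
  have "norm (integral {a..b} (\<lambda>t. cis (t * y) * \<phi> t)) \<le> C / y" if y: "y > 0" for y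
  proof -
    let ?P = "\<lambda>t. cis (t * y) * \<phi> t"
    have hi: "((\<lambda>t. \<i> * of_real y * (cis (t * y) * \<phi> t) + cis (t * y) * \<phi>' t) has_integral ?P b - ?P a) {a..b}"
    proof (rule fundamental_theorem_of_calculus[OF ab])
      fix t assume t: "t \<in> {a..b}"
      have "((\<lambda>t. cis (t * y)) has_vector_derivative \<i> * of_real y * cis (t * y)) (at t within {a..b})"
        unfolding has_vector_derivative_def
        by (auto intro!: derivative_eq_intros simp: scaleR_conv_of_real mult_ac)
      from has_vector_derivative_mult[OF this \<phi>[OF t]]
      show "(?P has_vector_derivative \<i> * of_real y * (cis (t * y) * \<phi> t) + cis (t * y) * \<phi>' t) (at t within {a..b})"
        by (simp add: algebra_simps)
    qed
    have i1: "(\<lambda>t. cis (t * y) * \<phi>' t) integrable_on {a..b}"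
      by (intro integrable_continuous_real continuous_intros \<phi>')
    have i2: "(\<lambda>t. cis (t * y) * \<phi> t) integrable_on {a..b}"
      by (intro integrable_continuous_real continuous_intros c\<phi>)
    have "\<i> * of_real y * integral {a..b} (\<lambda>t. cis (t * y) * \<phi> t)
        + integral {a..b} (\<lambda>t. cis (t * y) * \<phi>' t) = ?P b - ?P a"
      by (rule has_integral_unique[OF has_integral_add[OF has_integral_mult_right[OF integrable_integral[OF i2]]
              integrable_integral[OF i1]] hi])
    then have eq: "\<i> * of_real y * integral {a..b} (\<lambda>t. cis (t * y) * \<phi> t)
        = ?P b - ?P a - integral {a..b} (\<lambda>t. cis (t * y) * \<phi>' t)" by (simp add: algebra_simps)
    have "norm (integral {a..b} (\<lambda>t. cis (t * y) * \<phi>' t)) \<le> B * (b - a)"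
      by (rule integral_bound[OF ab]) (auto intro!: continuous_intros \<phi>' simp: norm_mult B)
    moreover have "norm (?P b - ?P a) \<le> norm (\<phi> b) + norm (\<phi> a)"
      by (rule order.trans[OF norm_triangle_ineq4]) (simp add: norm_mult)
    ultimately have "norm (?P b - ?P a - integral {a..b} (\<lambda>t. cis (t * y) * \<phi>' t)) \<le> C"
      unfolding C_def using norm_triangle_ineq4[of "?P b - ?P a" "integral {a..b} (\<lambda>t. cis (t * y) * \<phi>' t)"] by linarith
    then have "y * norm (integral {a..b} (\<lambda>t. cis (t * y) * \<phi> t)) \<le> C"
      using y unfolding eq[symmetric] by (simp add: norm_mult)
    then show ?thesis using y by (simp add: field_simps)
  qed
  then have "\<forall>\<^sub>F y in at_top. norm (integral {a..b} (\<lambda>t. cis (t * y) * \<phi> t)) \<le> C / y"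
    by (rule eventually_mono[OF eventually_gt_at_top[of 0]])
  moreover have "((\<lambda>y. C / y) \<longlongrightarrow> 0) at_top" by real_asymp
  ultimately show ?thesis by (rule Lim_null_comparison)
qed

text \<open>Since \<open>mangoldt_remainder\<close> is holomorphic across the line, its restriction
  there times the triangle weight is continuously differentiable, so \<open>riemann_lebesgue\<close>
  applies.\<close>

lemma fejer_remainder_at_top:
  assumes l: "l > 0"
  shows "((\<lambda>y. fejer_remainder l y 0) \<longlongrightarrow> 0) at_top"
proof -
  obtain S where S: "open S" "{s. Re s \<ge> 1} \<subseteq> S" and hol: "mangoldt_remainder holomorphic_on S"
    using mangoldt_remainder_holomorphic .
  let ?h = mangoldt_remainder
  let ?\<phi> = "\<lambda>t. of_real (1 - t / l) * ?h (Complex 1 t)"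
  let ?\<phi>' = "\<lambda>t. of_real (1 - t / l) * (\<i> * deriv ?h (Complex 1 t)) + of_real (- 1 / l) * ?h (Complex 1 t)"
  have der: "(?\<phi> has_vector_derivative ?\<phi>' t) (at t within A)" for t A
  proof (rule has_vector_derivative_mult)
    show "((\<lambda>t. complex_of_real (1 - t / l)) has_vector_derivative of_real (- 1 / l)) (at t within A)"
      by (intro has_vector_derivative_of_real) (use l in \<open>auto intro!: derivative_eq_intros\<close>)
    have "(Complex 1 has_vector_derivative \<i>) (at t)"
    proof -
      have "((\<lambda>t. 1 + \<i> * of_real t) has_vector_derivative 0 + \<i> * of_real 1) (at t)"
        by (intro derivative_intros)
      moreover have "(\<lambda>t. 1 + \<i> * of_real t) = Complex 1" by (auto simp: complex_eq_iff)
      ultimately show ?thesis by simp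
    qed
    moreover have "(?h has_field_derivative deriv ?h (Complex 1 t)) (at (Complex 1 t))"
      by (rule holomorphic_derivI[OF hol S(1)]) (use S(2) in auto)
    ultimately have "(?h \<circ> Complex 1 has_vector_derivative \<i> * deriv ?h (Complex 1 t)) (at t)"
      by (rule field_vector_diff_chain_at)
    then show "((\<lambda>t. ?h (Complex 1 t)) has_vector_derivative \<i> * deriv ?h (Complex 1 t)) (at t within A)"
      by (simp add: o_def has_vector_derivative_at_within)
  qed
  have c1: "continuous_on A (\<lambda>t. ?h (Complex 1 t))" for A
    by (intro continuous_on_mangoldt_remainder continuous_intros) auto
  have c2: "continuous_on A (\<lambda>t. deriv ?h (Complex 1 t))" for A
    by (rule continuous_on_compose2[OF holomorphic_on_imp_continuous_on[OF holomorphic_deriv[OF hol S(1)]]])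
       (use S(2) in \<open>auto intro!: continuous_intros\<close>)
  have cont: "continuous_on {0..l} ?\<phi>'"
    using l by (intro continuous_intros c1 c2) auto
  have "((\<lambda>y. integral {0..l} (\<lambda>t. cis (t * y) * ?\<phi> t)) \<longlongrightarrow> 0) at_top"
    using l by (intro riemann_lebesgue[OF _ der cont]) auto
  then have "((\<lambda>y. Re (integral {0..l} (\<lambda>t. cis (t * y) * ?\<phi> t))) \<longlongrightarrow> Re 0) at_top"
    by (rule tendsto_Re)
  moreover have "Re (integral {0..l} (\<lambda>t. cis (t * y) * ?\<phi> t)) = fejer_remainder l y 0" for y
  proof -
    have "(\<lambda>t. cis (t * y) * ?\<phi> t) integrable_on {0..l}"
      using l by (intro integrable_continuous_real continuous_intros c1) auto
    from integral_linear[OF this bounded_linear_Re] show ?thesis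
      by (simp add: fejer_remainder_def o_def mult_ac)
  qed
  ultimately show ?thesis by simp
qed

text \<open>A bound for all \<open>y\<close> at once, since \<open>cis (t * y)\<close> has modulus
  1. It serves the uniform majorant in \<open>lorentz_mangoldt\<close>, where a limit at infinity
  would not be enough.\<close>

lemma fejer_remainder_bounded:
  assumes l: "l > 0"
  obtains C where "\<And>y. \<bar>fejer_remainder l y 0\<bar> \<le> C"
proof -
  have c: "continuous_on {0..l} (\<lambda>t. mangoldt_remainder (Complex 1 t))"
    by (intro continuous_on_mangoldt_remainder continuous_intros) auto
  obtain B where B: "\<And>t. t \<in> {0..l} \<Longrightarrow> norm (mangoldt_remainder (Complex 1 t)) \<le> B"
    using compact_imp_bounded[OF compact_continuous_image[OF c compact_Icc]] unfolding bounded_iff by blast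
  have "norm (fejer_remainder l y 0) \<le> B * (l - 0)" for y
    unfolding fejer_remainder_def
  proof (rule integral_bound)
    show "continuous_on {0..l} (\<lambda>t. Re (of_real (1 - t / l) * cis (t * y) * mangoldt_remainder (Complex (1 + 0) t)))"
      using c l by (intro continuous_intros) auto
    fix t assume t: "t \<in> {0..l}"
    have "norm (of_real (1 - t / l) * cis (t * y) * mangoldt_remainder (Complex (1 + 0) t)) \<le> 1 * B"
      unfolding norm_mult norm_of_real norm_cis using t l B[OF t] by (intro mult_mono) (auto simp: field_simps)
    then show "norm (Re (of_real (1 - t / l) * cis (t * y) * mangoldt_remainder (Complex (1 + 0) t))) \<le> B"
      using abs_Re_le_cmod order_trans by (metis mult_1 real_norm_def)
  qed (use l in simp)
  then show ?thesis using that by auto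
qed

section \<open>Averages of the von Mangoldt function\<close>

text \<open>The increment of \<open>arctan (ln x - y)\<close> is, by the mean value theorem, its
  derivative at some \<open>z\<close> between \<open>n\<close> and \<open>n + 1\<close>. Replacing
  \<open>z\<close> by \<open>n\<close> costs a factor 2 since \<open>z \<le> 2 * n\<close>, and a
  factor 3 in the Lorentz weight since \<open>ln z\<close> differs from \<open>ln n\<close> by at
  most 1.\<close>

lemma lorentz_le_arctan_diff:
  fixes y :: real
  assumes n: "n > 0"
  shows "1 / real n / (1 + (y - ln (real n))\<^sup>2) \<le> 6 * (arctan (ln (real (Suc n)) - y) - arctan (ln (real n) - y))"
proof -
  have "\<exists>z. real n < z \<and> z < real (Suc n) \<and>
      arctan (ln (real (Suc n)) - y) - arctan (ln (real n) - y)
        = (real (Suc n) - real n) * (inverse (1 + (ln z - y)\<^sup>2) * (1 / z))"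
  proof (rule MVT2)
    fix x assume "real n \<le> x"
    then have x: "x > 0" using n by linarith
    have "((\<lambda>x. ln x - y) has_real_derivative 1 / x) (at x)"
      using x by (auto intro!: derivative_eq_intros)
    from DERIV_chain2[OF DERIV_arctan this]
    show "((\<lambda>x. arctan (ln x - y)) has_real_derivative inverse (1 + (ln x - y)\<^sup>2) * (1 / x)) (at x)" .
  qed simp
  then obtain z where z: "real n < z" "z < real (Suc n)"
    and eq: "arctan (ln (real (Suc n)) - y) - arctan (ln (real n) - y) = inverse (1 + (ln z - y)\<^sup>2) * (1 / z)"
    by auto
  define a where "a = y - ln (real n)"
  define b where "b = ln z - ln (real n)"
  have pos: "0 < real n" "0 < z" using n z by auto
  have z2: "z \<le> 2 * real n" using z n by (simp add: Suc_le_eq)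
  have b0: "0 \<le> b" using z pos by (simp add: b_def)
  have "b = ln (z / real n)" using pos by (simp add: b_def ln_div)
  also have "\<dots> \<le> z / real n - 1" using pos by (intro ln_le_minus_one) simp
  also have "\<dots> \<le> 1" using z2 pos by (simp add: field_simps)
  finally have b1: "b\<^sup>2 \<le> 1" using b0 by (simp add: power_le_one)
  have "(ln z - y)\<^sup>2 = (b - a)\<^sup>2" by (simp add: a_def b_def)
  also have "\<dots> \<le> 2 * b\<^sup>2 + 2 * a\<^sup>2"
    using zero_le_power2[of "b + a"] by (simp add: power2_eq_square algebra_simps)
  finally have zy: "(ln z - y)\<^sup>2 \<le> 2 * b\<^sup>2 + 2 * a\<^sup>2" .
  have "1 + X \<le> 3 * (1 + A)" if "X \<le> 2 * B + 2 * A" "B \<le> 1" "0 \<le> A" for X A B :: real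
    using that by simp
  from this[OF zy b1] have "1 + (ln z - y)\<^sup>2 \<le> 3 * (1 + a\<^sup>2)" by simp
  then have "z * (1 + (ln z - y)\<^sup>2) \<le> (2 * real n) * (3 * (1 + a\<^sup>2))"
    using z2 pos by (intro mult_mono) auto
  moreover have "(2 * p) * (3 * q) = 6 * (p * q)" for p q :: real by simp
  ultimately have le: "z * (1 + (ln z - y)\<^sup>2) \<le> 6 * (real n * (1 + a\<^sup>2))" by (simp only:)
  have pos': "0 < z * (1 + (ln z - y)\<^sup>2)" using pos by (intro mult_pos_pos) (auto intro: add_pos_nonneg)
  have "1 / (6 * (real n * (1 + a\<^sup>2))) \<le> 1 / (z * (1 + (ln z - y)\<^sup>2))"
    by (rule divide_left_mono[OF le _ mult_pos_pos[OF pos' less_le_trans[OF pos' le], unfolded mult.commute[of "z * _"]]]) simp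
  also have "\<dots> = inverse (1 + (ln z - y)\<^sup>2) * (1 / z)" by (simp add: field_simps)
  finally have key: "1 / (6 * (real n * (1 + a\<^sup>2))) \<le> inverse (1 + (ln z - y)\<^sup>2) * (1 / z)" .
  show ?thesis
    using mult_left_mono[OF key, of 6] unfolding eq a_def[symmetric] divide_divide_eq_left by simp
qed

lemma lorentz_partial_sum_le:
  "(\<Sum>n<M. 1 / real n / (1 + (y - ln (real n))\<^sup>2)) \<le> 6 * pi"
proof -
  have "(\<Sum>n<M. 1 / real n / (1 + (y - ln (real n))\<^sup>2)) \<le> (\<Sum>n<Suc M. 1 / real n / (1 + (y - ln (real n))\<^sup>2))"
    by simp
  also have "\<dots> = (\<Sum>n<M. 1 / real (Suc n) / (1 + (y - ln (real (Suc n)))\<^sup>2))"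
    by (subst sum.lessThan_Suc_shift) simp
  also have "\<dots> \<le> (\<Sum>n<M. 6 * (arctan (ln (real (Suc (Suc n))) - y) - arctan (ln (real (Suc n)) - y)))"
    by (intro sum_mono lorentz_le_arctan_diff) simp
  also have "\<dots> = 6 * (arctan (ln (real (Suc M)) - y) - arctan (ln (real (Suc 0)) - y))"
    unfolding sum_distrib_left[symmetric] by (subst sum_lessThan_telescope) simp
  also have "\<dots> \<le> 6 * pi"
    using arctan_bounded[of "ln (real (Suc M)) - y"] arctan_bounded[of "ln (real (Suc 0)) - y"] by simp
  finally show ?thesis .
qed

lemma summable_lorentz: "summable (\<lambda>n. 1 / real n / (1 + (y - ln (real n))\<^sup>2))"
  and suminf_lorentz_le: "(\<Sum>n. 1 / real n / (1 + (y - ln (real n))\<^sup>2)) \<le> 6 * pi"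
proof -
  show "summable (\<lambda>n. 1 / real n / (1 + (y - ln (real n))\<^sup>2))"
    by (rule bounded_imp_summable[OF _ lorentz_partial_sum_le[where M = "Suc _", unfolded lessThan_Suc_atMost]]) simp
  then show "(\<Sum>n. 1 / real n / (1 + (y - ln (real n))\<^sup>2)) \<le> 6 * pi"
    by (rule suminf_le_const) (rule lorentz_partial_sum_le)
qed

lemma fejer_harmonic:
  assumes l: "l > 0"
  shows "summable (\<lambda>n. 1 / real n * fejer l (y - ln (real n)))"
    and "(\<Sum>n. 1 / real n * fejer l (y - ln (real n))) \<le> (l / 2 + 2 / l) * (6 * pi)"
proof -
  let ?C = "l / 2 + 2 / l"
  have le: "1 / real n * fejer l (y - ln (real n)) \<le> ?C * (1 / real n / (1 + (y - ln (real n))\<^sup>2))" for n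
    using mult_left_mono[OF fejer_le_lorentz[OF l, of "y - ln (real n)"], of "1 / real n"] by (simp add: mult_ac)
  show s: "summable (\<lambda>n. 1 / real n * fejer l (y - ln (real n)))"
    by (rule summable_comparison_test'[OF summable_mult[OF summable_lorentz, of ?C], of 0])
       (use le fejer_nonneg[OF l] in simp)
  have "(\<Sum>n. 1 / real n * fejer l (y - ln (real n))) \<le> (\<Sum>n. ?C * (1 / real n / (1 + (y - ln (real n))\<^sup>2)))"
    by (intro suminf_le le s summable_mult summable_lorentz)
  also have "\<dots> = ?C * (\<Sum>n. 1 / real n / (1 + (y - ln (real n))\<^sup>2))"
    by (rule suminf_mult[OF summable_lorentz])
  also have "\<dots> \<le> ?C * (6 * pi)"
    using l by (intro mult_left_mono suminf_lorentz_le) auto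
  finally show "(\<Sum>n. 1 / real n * fejer l (y - ln (real n))) \<le> ?C * (6 * pi)" .
qed

lemma powr_neg_le_inverse:
  assumes "\<delta> \<ge> 0"
  shows "real n powr (- (1 + \<delta>)) \<le> 1 / real n"
proof (cases "n = 0")
  case False
  then have "real n powr (- (1 + \<delta>)) \<le> real n powr (- 1)" using assms by (intro powr_mono) auto
  then show ?thesis using False by (simp add: powr_minus_divide)
qed simp

lemma powr_neg_tendsto_inverse:
  "((\<lambda>\<delta>. real n powr (- (1 + \<delta>))) \<longlongrightarrow> 1 / real n) (at_right 0)"
proof (cases "n = 0")
  case False
  then have "((\<lambda>\<delta>. real n powr (- (1 + \<delta>))) \<longlongrightarrow> real n powr (- (1 + 0))) (at_right 0)"
    by (intro tendsto_intros) auto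
  then show ?thesis using False by (simp add: powr_minus_divide)
qed simp

text \<open>The limit \<open>\<delta> \<rightarrow> 0\<close> in \<open>fejer_sum\<close> only needs finite sums, since all terms are nonnegative.\<close>

lemma fejer_mangoldt:
  assumes l: "l > 0"
  shows "summable (\<lambda>n. mangoldt n / real n * fejer l (y - ln (real n)))"
    and "(\<Sum>n. mangoldt n / real n * fejer l (y - ln (real n)))
           = (\<Sum>n. 1 / real n * fejer l (y - ln (real n))) + fejer_remainder l y 0"
proof -
  let ?F = "\<lambda>n. fejer l (y - ln (real n))"
  let ?p = "\<lambda>\<delta> n. real n powr (- (1 + \<delta>))"
  note F0 = fejer_nonneg[OF l]
  note s1 = fejer_harmonic(1)[OF l, of y]
  have sz: "summable (\<lambda>n. ?p \<delta> n * ?F n)" if "\<delta> > 0" for \<delta>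
  proof (rule summable_comparison_test'[OF s1, of 0])
    show "norm (?p \<delta> n * ?F n) \<le> 1 / real n * ?F n" for n
      unfolding real_norm_def abs_mult abs_of_nonneg[OF F0]
      using powr_neg_le_inverse[of \<delta> n] that by (intro mult_right_mono F0) auto
  qed
  have zle: "(\<Sum>n. ?p \<delta> n * ?F n) \<le> (\<Sum>n. 1 / real n * ?F n)" if "\<delta> > 0" for \<delta>
    by (intro suminf_le sz s1 mult_right_mono powr_neg_le_inverse F0 that less_imp_le)
  have sm: "(\<lambda>n. mangoldt n * ?p \<delta> n * ?F n) sums (fejer_remainder l y \<delta> + (\<Sum>n. ?p \<delta> n * ?F n))" if "\<delta> > 0" for \<delta>
    using sums_add[OF fejer_sum[OF l that, of y] summable_sums[OF sz[OF that]]] by (simp add: algebra_simps)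
  \<comment> \<open>With \<open>M\<close> fixed the limit passes through the finite sum, and
    truncation only costs an inequality. The bound does not depend on \<open>M\<close>, so it also
    yields summability at \<open>\<delta> = 0\<close>.\<close>
  have upper: "(\<Sum>n<M. mangoldt n / real n * ?F n) \<le> fejer_remainder l y 0 + (\<Sum>n. 1 / real n * ?F n)" for M
  proof (rule tendsto_le)
    show "((\<lambda>\<delta>. \<Sum>n<M. mangoldt n * ?p \<delta> n * ?F n) \<longlongrightarrow> (\<Sum>n<M. mangoldt n / real n * ?F n)) (at_right 0)"
    proof -
      have "((\<lambda>\<delta>. \<Sum>n<M. mangoldt n * ?p \<delta> n * ?F n) \<longlongrightarrow> (\<Sum>n<M. mangoldt n * (1 / real n) * ?F n)) (at_right 0)"
        by (intro tendsto_sum tendsto_mult powr_neg_tendsto_inverse tendsto_const)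
      then show ?thesis by simp
    qed
    show "((\<lambda>\<delta>. fejer_remainder l y \<delta> + (\<Sum>n. 1 / real n * ?F n)) \<longlongrightarrow> fejer_remainder l y 0 + (\<Sum>n. 1 / real n * ?F n)) (at_right 0)"
      by (intro tendsto_intros fejer_remainder_tendsto l)
    show "\<forall>\<^sub>F \<delta> in at_right 0. (\<Sum>n<M. mangoldt n * ?p \<delta> n * ?F n) \<le> fejer_remainder l y \<delta> + (\<Sum>n. 1 / real n * ?F n)"
      using eventually_at_right_less[of 0]
    proof eventually_elim
      case (elim \<delta>)
      have "(\<Sum>n<M. mangoldt n * ?p \<delta> n * ?F n) \<le> (\<Sum>n. mangoldt n * ?p \<delta> n * ?F n)"
        using sm[OF elim] by (intro sum_le_suminf) (auto simp: sums_iff mangoldt_nonneg F0)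
      also have "\<dots> \<le> fejer_remainder l y \<delta> + (\<Sum>n. 1 / real n * ?F n)"
        using sm[OF elim] zle[OF elim] by (simp add: sums_iff)
      finally show ?case .
    qed
  qed simp
  show s: "summable (\<lambda>n. mangoldt n / real n * ?F n)"
    by (rule bounded_imp_summable[OF _ upper[of "Suc _", unfolded lessThan_Suc_atMost]]) (simp add: mangoldt_nonneg F0)
  \<comment> \<open>The reverse inequality, by the same argument with the harmonic sum truncated
    instead.\<close>
  have "(\<Sum>n<M. 1 / real n * ?F n) \<le> (\<Sum>n. mangoldt n / real n * ?F n) - fejer_remainder l y 0" for M
  proof (rule tendsto_le)
    show "((\<lambda>\<delta>. \<Sum>n<M. ?p \<delta> n * ?F n) \<longlongrightarrow> (\<Sum>n<M. 1 / real n * ?F n)) (at_right 0)"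
      by (intro tendsto_sum tendsto_mult powr_neg_tendsto_inverse tendsto_const)
    show "((\<lambda>\<delta>. (\<Sum>n. mangoldt n / real n * ?F n) - fejer_remainder l y \<delta>) \<longlongrightarrow> (\<Sum>n. mangoldt n / real n * ?F n) - fejer_remainder l y 0) (at_right 0)"
      by (intro tendsto_intros fejer_remainder_tendsto l)
    show "\<forall>\<^sub>F \<delta> in at_right 0. (\<Sum>n<M. ?p \<delta> n * ?F n) \<le> (\<Sum>n. mangoldt n / real n * ?F n) - fejer_remainder l y \<delta>"
      using eventually_at_right_less[of 0]
    proof eventually_elim
      case (elim \<delta>)
      have "(\<Sum>n<M. ?p \<delta> n * ?F n) \<le> (\<Sum>n. ?p \<delta> n * ?F n)"
        by (intro sum_le_suminf sz elim) (auto simp: F0)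
      also have "\<dots> = (\<Sum>n. mangoldt n * ?p \<delta> n * ?F n) - fejer_remainder l y \<delta>"
        using sm[OF elim] by (simp add: sums_iff)
      also have "(\<Sum>n. mangoldt n * ?p \<delta> n * ?F n) \<le> (\<Sum>n. mangoldt n / real n * ?F n)"
      proof (rule suminf_le)
        show "mangoldt n * ?p \<delta> n * ?F n \<le> mangoldt n / real n * ?F n" for n
          using mult_left_mono[OF powr_neg_le_inverse[of \<delta> n] mangoldt_nonneg[of n]] elim
          by (intro mult_right_mono F0) auto
      qed (use s sm[OF elim] in \<open>auto simp: sums_iff\<close>)
      finally show ?case by simp
    qed
  qed simp
  then have "(\<Sum>n. 1 / real n * ?F n) \<le> (\<Sum>n. mangoldt n / real n * ?F n) - fejer_remainder l y 0"
    by (rule suminf_le_const[OF s1])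
  moreover have "(\<Sum>n. mangoldt n / real n * ?F n) \<le> fejer_remainder l y 0 + (\<Sum>n. 1 / real n * ?F n)"
    by (rule suminf_le_const[OF s upper])
  ultimately show "(\<Sum>n. mangoldt n / real n * ?F n) = (\<Sum>n. 1 / real n * ?F n) + fejer_remainder l y 0"
    by simp
qed

text \<open>A single kernel has zeros, but its shift by \<open>pi\<close> fills them: the numerators
  \<open>1 - cos u\<close> and \<open>1 + cos u\<close> add up to 2. The constant comes from
  bounding both denominators by \<open>32 * (1 + u\<^sup>2)\<close>.\<close>

lemma lorentz_le_fejer:
  "1 / (1 + u\<^sup>2) \<le> 16 * (fejer 1 u + fejer 1 (u + pi))"
proof -
  define m where "m = max (u\<^sup>2) ((u + pi)\<^sup>2)"
  have sq: "fejer 1 v * v\<^sup>2 = 1 - cos v" for v by (simp add: fejer_def)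
  have "1 - cos u \<le> fejer 1 u * m"
    using mult_left_mono[of "u\<^sup>2" m "fejer 1 u"] sq[of u] by (simp add: m_def fejer_nonneg)
  moreover have "1 + cos u \<le> fejer 1 (u + pi) * m"
    using mult_left_mono[of "(u + pi)\<^sup>2" m "fejer 1 (u + pi)"] sq[of "u + pi"] by (simp add: m_def fejer_nonneg)
  ultimately have "2 \<le> (fejer 1 u + fejer 1 (u + pi)) * m" by (simp add: algebra_simps)
  also have "m \<le> 32 * (1 + u\<^sup>2)"
  proof -
    have "(u + pi)\<^sup>2 \<le> 2 * u\<^sup>2 + 2 * pi\<^sup>2"
      using zero_le_power2[of "u - pi"] by (simp add: power2_eq_square algebra_simps)
    moreover have "pi\<^sup>2 \<le> 4\<^sup>2" using pi_less_4 by (intro power_mono) auto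
    ultimately have "(u + pi)\<^sup>2 \<le> 2 * u\<^sup>2 + 32" by simp
    moreover have "0 \<le> u\<^sup>2" by simp
    moreover have "max U X \<le> 32 * (1 + U)" if "X \<le> 2 * U + 32" "0 \<le> U" for U X :: real
      using that by simp
    ultimately show ?thesis unfolding m_def by blast
  qed
  finally have "2 \<le> (fejer 1 u + fejer 1 (u + pi)) * (32 * (1 + u\<^sup>2))"
    by (simp add: fejer_nonneg add_nonneg_nonneg mult_left_mono)
  then show ?thesis by (simp add: pos_divide_le_eq add_pos_nonneg algebra_simps)
qed

text \<open>A bound of Chebyshev type, uniform in \<open>y\<close>. The Lorentz weight is dominated
  by the kernels with \<open>l = 1\<close> centred at \<open>y\<close> and \<open>y + pi\<close>,
  and \<open>fejer_mangoldt\<close> trades \<Lambda> for the constant 1 up to a bounded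
  remainder.\<close>

lemma lorentz_mangoldt:
  obtains C where "C > 0" "\<And>y. summable (\<lambda>n. mangoldt n / real n / (1 + (y - ln (real n))\<^sup>2))"
    "\<And>y. (\<Sum>n. mangoldt n / real n / (1 + (y - ln (real n))\<^sup>2)) \<le> C"
proof -
  obtain R where R: "\<And>y. \<bar>fejer_remainder 1 y 0\<bar> \<le> R" using fejer_remainder_bounded[of 1] by auto
  define D where "D = (1 / 2 + 2 / 1) * (6 * pi) + R"
  have D: "(\<Sum>n. mangoldt n / real n * fejer 1 (y - ln (real n))) \<le> D" for y
    using fejer_mangoldt(2)[of 1 y] fejer_harmonic(2)[of 1 y] R[of y] by (simp add: D_def)
  have D0: "D \<ge> 0" using R[of 0] by (simp add: D_def)
  let ?f = "\<lambda>y n. 16 * (mangoldt n / real n * fejer 1 (y - ln (real n)) + mangoldt n / real n * fejer 1 (y + pi - ln (real n)))"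
  have le: "mangoldt n / real n / (1 + (y - ln (real n))\<^sup>2) \<le> ?f y n" for y n
    using mult_left_mono[OF lorentz_le_fejer[of "y - ln (real n)"], of "mangoldt n / real n"]
    by (simp add: mangoldt_nonneg algebra_simps)
  have sF: "summable (\<lambda>n. mangoldt n / real n * fejer 1 (y - ln (real n)))" for y
    by (rule fejer_mangoldt(1)) simp
  have sf: "summable (?f y)" for y
    by (intro summable_mult summable_add sF)
  have s: "summable (\<lambda>n. mangoldt n / real n / (1 + (y - ln (real n))\<^sup>2))" for y
    by (rule summable_comparison_test'[OF sf[of y], of 0])
       (use le[of _ y] in \<open>auto simp: mangoldt_nonneg add_nonneg_nonneg\<close>)
  have "(\<Sum>n. mangoldt n / real n / (1 + (y - ln (real n))\<^sup>2)) \<le> 32 * D + 1" for y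
  proof -
    have "(\<Sum>n. mangoldt n / real n / (1 + (y - ln (real n))\<^sup>2)) \<le> suminf (?f y)"
      by (intro suminf_le le s sf)
    also have "\<dots> = 16 * ((\<Sum>n. mangoldt n / real n * fejer 1 (y - ln (real n))) + (\<Sum>n. mangoldt n / real n * fejer 1 (y + pi - ln (real n))))"
      using suminf_mult[OF summable_add[OF sF[of y] sF[of "y + pi"]], of 16]
      unfolding suminf_add[OF sF[of y] sF[of "y + pi"]] by simp
    also have "\<dots> \<le> 32 * D + 1" using D[of y] D[of "y + pi"] by simp
    finally show ?thesis .
  qed
  then show ?thesis using that[of "32 * D + 1"] D0 s by auto
qed

section \<open>Lower bound on short logarithmic intervals\<close>

text \<open>For integers between \<open>exp y\<close> and \<open>exp (y + 1 / l)\<close> the kernel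
  is at least \<open>l / 8\<close>, and their reciprocals add up to at least
  \<open>1 / (2 * l)\<close>. The product is independent of \<open>l\<close>, which lets the kernel
  be sharpened later.\<close>

lemma fejer_harmonic_ge:
  assumes l: "l > 0"
  shows "\<forall>\<^sub>F y in at_top. 1 / 16 \<le> (\<Sum>n. 1 / real n * fejer l (y - ln (real n)))"
proof -
  \<comment> \<open>Rounding \<open>exp y\<close> up to an integer moves its logarithm by at most
    \<open>exp (- y)\<close>; this is to cost no more than half of the length
    \<open>1 / l\<close>.\<close>
  have "\<forall>\<^sub>F y::real in at_top. exp (- y) \<le> 1 / (2 * l)" using l by real_asymp
  then show ?thesis using eventually_ge_at_top[of 0]
  proof eventually_elim
    case (elim y)
    define a where "a = nat \<lceil>exp y\<rceil>"
    define b where "b = nat \<lfloor>exp (y + 1 / l)\<rfloor>"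
    have a: "exp y \<le> real a" "real a < exp y + 1" by (auto simp: a_def) linarith
    have b: "real b \<le> exp (y + 1 / l)" "exp (y + 1 / l) < real (Suc b)" by (auto simp: b_def) linarith
    have a0: "real a > 0" using a exp_gt_zero[of y] by linarith
    then have a0': "a > 0" by simp
    have near: "l / 8 \<le> fejer l (y - ln (real n))" if "n \<in> {a..<Suc b}" for n
    proof (rule fejer_ge[OF l])
      have n: "exp y \<le> real n" "real n \<le> exp (y + 1 / l)" using that a b by (auto intro: order.trans)
      have n0: "real n > 0" using n exp_gt_zero[of y] by linarith
      have "y \<le> ln (real n)" using n n0 by (simp add: ln_ge_iff)
      moreover have "ln (real n) \<le> y + 1 / l" using n n0 by (metis exp_gt_zero ln_exp ln_le_cancel_iff)
      ultimately have "\<bar>y - ln (real n)\<bar> \<le> 1 / l" by simp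
      then have "l * \<bar>y - ln (real n)\<bar> \<le> l * (1 / l)" using l by (intro mult_left_mono) auto
      then show "\<bar>l * (y - ln (real n))\<bar> \<le> 1" unfolding abs_mult using l by simp
    qed
    have "ln (real a) \<le> ln (exp y * (1 + exp (- y)))"
    proof -
      have "exp y * (1 + exp (- y)) = exp y + 1" by (simp add: algebra_simps flip: exp_add)
      then show ?thesis using a a0 by simp
    qed
    also have "\<dots> = y + ln (1 + exp (- y))" by (subst ln_mult_pos) (auto intro: add_pos_pos)
    also have "\<dots> \<le> y + exp (- y)" using ln_add_one_self_le_self[of "exp (- y)"] by simp
    finally have la: "ln (real a) \<le> y + exp (- y)" .
    have "y + 1 / l = ln (exp (y + 1 / l))" by simp
    also have "\<dots> \<le> ln (real (Suc b))" using b by (subst ln_le_cancel_iff) auto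
    finally have lb: "y + 1 / l \<le> ln (real (Suc b))" .
    have half: "1 / l - 1 / (2 * l) = 1 / (2 * l)" using l by (simp add: field_simps)
    have diff: "1 / (2 * l) \<le> ln (real (Suc b)) - ln (real a)" using la lb elim half by linarith
    moreover have "0 < 1 / (2 * l)" using l by simp
    ultimately have "ln (real a) < ln (real (Suc b))" by linarith
    then have ab: "a \<le> Suc b" using a0 by simp
    note diff
    also have "ln (real (Suc b)) - ln (real a) = (\<Sum>n=a..<Suc b. ln (real (Suc n)) - ln (real n))"
      using ab by (rule sum_Suc_diff'[symmetric])
    also have "\<dots> \<le> (\<Sum>n=a..<Suc b. 1 / real n)"
    proof (rule sum_mono)
      fix n assume "n \<in> {a..<Suc b}"
      then have n: "n > 0" using a0' by auto
      then have "ln (real (Suc n)) - ln (real n) = ln (real (Suc n) / real n)" by (simp add: ln_div)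
      also have "\<dots> \<le> real (Suc n) / real n - 1" using n by (intro ln_le_minus_one) simp
      also have "\<dots> = 1 / real n" using n by (simp add: field_simps)
      finally show "ln (real (Suc n)) - ln (real n) \<le> 1 / real n" .
    qed
    finally have "1 / (2 * l) * (l / 8) \<le> (\<Sum>n=a..<Suc b. 1 / real n) * (l / 8)"
      using l by (intro mult_right_mono) auto
    also have "\<dots> = (\<Sum>n=a..<Suc b. 1 / real n * (l / 8))" by (rule sum_distrib_right)
    also have "\<dots> \<le> (\<Sum>n=a..<Suc b. 1 / real n * fejer l (y - ln (real n)))"
      by (intro sum_mono mult_left_mono near) auto
    also have "\<dots> \<le> (\<Sum>n. 1 / real n * fejer l (y - ln (real n)))"
      by (intro sum_le_suminf fejer_harmonic l) (auto simp: fejer_nonneg l)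
    finally show ?case using l by (simp add: field_simps)
  qed
qed

text \<open>Of the mass 1/16 supplied by \<open>fejer_harmonic_ge\<close>, the remainder and the
  terms with \<open>ln n\<close> at distance at least \<epsilon> from \<open>y\<close> each take at
  most 1/64. So at least 1/32 comes from the near terms, where the kernel is at most
  \<open>l / 2\<close>.\<close>

lemma mangoldt_short_interval:
  assumes \<epsilon>: "\<epsilon> > 0"
  obtains c where "c > 0"
    "\<forall>\<^sub>F y in at_top. c \<le> (\<Sum>n | n > 0 \<and> \<bar>y - ln (real n)\<bar> < \<epsilon>. mangoldt n / real n)"
proof -
  obtain C where C0: "C > 0" and sC: "\<And>y. summable (\<lambda>n. mangoldt n / real n / (1 + (y - ln (real n))\<^sup>2))"
    and C: "\<And>y. (\<Sum>n. mangoldt n / real n / (1 + (y - ln (real n))\<^sup>2)) \<le> C"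
    by (rule lorentz_mangoldt) (rule that)
  \<comment> \<open>Chosen so that \<open>1 + u\<^sup>2 \<le> D * u\<^sup>2\<close> whenever
    \<open>\<bar>u\<bar> \<ge> \<epsilon>\<close>.\<close>
  define D where "D = 1 + 1 / \<epsilon>\<^sup>2"
  have D0: "D > 0" by (simp add: D_def add_pos_nonneg)
  \<comment> \<open>Makes the far contribution \<open>2 / l * D * C\<close> equal to 1/64.\<close>
  define l where "l = 128 * D * C"
  have l: "l > 0" using C0 D0 by (simp add: l_def)
  define P where "P = (\<lambda>y. {n. n > 0 \<and> \<bar>y - ln (real n)\<bar> < \<epsilon>})"
  have fin: "finite (P y)" for y
  proof (rule finite_subset)
    show "P y \<subseteq> {..nat \<lceil>exp (y + \<epsilon>)\<rceil>}"
    proof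
      fix n assume "n \<in> P y"
      then have n: "n > 0" "ln (real n) \<le> y + \<epsilon>" by (auto simp: P_def)
      then have "real n \<le> exp (y + \<epsilon>)" by (metis exp_le_cancel_iff exp_ln of_nat_0_less_iff)
      then show "n \<in> {..nat \<lceil>exp (y + \<epsilon>)\<rceil>}" by (simp add: le_nat_iff) linarith
    qed
  qed simp
  have far: "mangoldt n / real n * fejer l (y - ln (real n)) \<le>
      l / 2 * (if n \<in> P y then mangoldt n / real n else 0)
      + 2 / l * D * (mangoldt n / real n / (1 + (y - ln (real n))\<^sup>2))" for n y
  proof -
    let ?u = "y - ln (real n)" and ?w = "mangoldt n / real n :: real"
    have w: "0 \<le> ?w" by (simp add: mangoldt_nonneg)
    have p: "1 + ?u\<^sup>2 > 0" by (simp add: add_pos_nonneg)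
    consider "n = 0" | "n \<in> P y" | "n > 0" "\<epsilon> \<le> \<bar>?u\<bar>" unfolding P_def by force
    then show ?thesis
    proof cases
      case 2
      have "?w * fejer l ?u \<le> ?w * (l / 2)" by (intro mult_left_mono fejer_le l w)
      moreover have "0 \<le> 2 / l * D * (?w / (1 + ?u\<^sup>2))" 
        by (intro mult_nonneg_nonneg[OF mult_nonneg_nonneg divide_nonneg_pos[OF w p]]) (use l D0 in auto)
      ultimately show ?thesis using 2 by (simp add: mult.commute)
    next
      case 3
      have "\<epsilon>\<^sup>2 \<le> ?u\<^sup>2" using 3 \<epsilon> by (metis abs_le_square_iff abs_of_pos)
      then have u: "?u\<^sup>2 > 0" "1 \<le> ?u\<^sup>2 / \<epsilon>\<^sup>2" using \<epsilon> zero_less_power[of \<epsilon> 2] by (auto simp del: zero_less_power)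
      have "fejer l ?u * (1 + ?u\<^sup>2) \<le> fejer l ?u * (D * ?u\<^sup>2)"
        using u by (intro mult_left_mono fejer_nonneg l) (simp add: D_def algebra_simps)
      also have "\<dots> = D * (fejer l ?u * ?u\<^sup>2)" by simp
      also have "\<dots> \<le> D * (2 / l)" using D0 by (intro mult_left_mono fejer_mult_square_le l) auto
      finally have "fejer l ?u \<le> D * (2 / l) / (1 + ?u\<^sup>2)" by (simp only: pos_le_divide_eq[OF p])
      from mult_left_mono[OF this w] have "?w * fejer l ?u \<le> 2 / l * D * (?w / (1 + ?u\<^sup>2))" by (simp add: mult_ac)
      moreover have "0 \<le> l / 2 * (if n \<in> P y then ?w else 0)" using l w by simp
      ultimately show ?thesis by linarith
    qed simp
  qed
  have upper: "(\<Sum>n. mangoldt n / real n * fejer l (y - ln (real n)))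
      \<le> l / 2 * (\<Sum>n\<in>P y. mangoldt n / real n) + 1 / 64" for y
  proof -
    have s: "(\<lambda>n. if n \<in> P y then mangoldt n / real n else 0) sums (\<Sum>n\<in>P y. mangoldt n / real n)"
      by (rule sums_If_finite_set[OF fin])
    have t: "(\<lambda>n. l / 2 * (if n \<in> P y then mangoldt n / real n else 0)
        + 2 / l * D * (mangoldt n / real n / (1 + (y - ln (real n))\<^sup>2))) sums
        (l / 2 * (\<Sum>n\<in>P y. mangoldt n / real n) + 2 / l * D * (\<Sum>n. mangoldt n / real n / (1 + (y - ln (real n))\<^sup>2)))"
      by (intro sums_add sums_mult s summable_sums sC)
    have "(\<Sum>n. mangoldt n / real n * fejer l (y - ln (real n))) \<le>
        l / 2 * (\<Sum>n\<in>P y. mangoldt n / real n) + 2 / l * D * (\<Sum>n. mangoldt n / real n / (1 + (y - ln (real n))\<^sup>2))"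
      by (rule sums_le[OF far summable_sums[OF fejer_mangoldt(1)[OF l]] t])
    also have "2 / l * D * (\<Sum>n. mangoldt n / real n / (1 + (y - ln (real n))\<^sup>2)) \<le> 2 / l * D * C"
      using l D0 by (intro mult_left_mono C) auto
    also have "2 / l * D * C = 1 / 64" using C0 D0 by (simp add: l_def)
    finally show ?thesis by simp
  qed
  have "\<forall>\<^sub>F y in at_top. \<bar>fejer_remainder l y 0\<bar> < 1 / 64"
    using tendstoD[OF fejer_remainder_at_top[OF l], of "1 / 64"] by simp
  then have "\<forall>\<^sub>F y in at_top. 1 / (16 * l) \<le> (\<Sum>n\<in>P y. mangoldt n / real n)"
    using fejer_harmonic_ge[OF l]
  proof eventually_elim
    case (elim y)
    have "1 / 32 \<le> l / 2 * (\<Sum>n\<in>P y. mangoldt n / real n)"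
      using elim upper[of y] fejer_mangoldt(2)[OF l, of y] by linarith
    then show ?case using l by (simp add: field_simps)
  qed
  then show ?thesis using that[of "1 / (16 * l)"] l by (simp add: P_def)
qed

section \<open>Primes in short intervals\<close>

text \<open>A proper prime power \<open>p ^ k \<le> X\<close> has \<open>k \<ge> 2\<close>, hence
  \<open>p \<le> sqrt X\<close>, and \<open>2 ^ k \<le> X\<close> bounds the exponent.\<close>

lemma card_prime_powers_le:
  fixes X :: real
  assumes X: "X \<ge> 1"
  shows "finite {n. real n \<le> X \<and> primepow n \<and> \<not> prime n}"
    and "real (card {n. real n \<le> X \<and> primepow n \<and> \<not> prime n}) \<le> (sqrt X + 1) * (ln X / ln 2 + 1)"
proof -
  let ?A = "{..nat \<lfloor>sqrt X\<rfloor>} \<times> {..nat \<lfloor>ln X / ln 2\<rfloor>}"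
  let ?Q = "{n. real n \<le> X \<and> primepow n \<and> \<not> prime n}"
  have sub: "?Q \<subseteq> (\<lambda>(p, k). p ^ k) ` ?A"
  proof
    fix n assume n: "n \<in> ?Q"
    then obtain p k where pk: "prime p" "k > 0" "n = p ^ k" by (auto simp: primepow_def)
    with n have "k \<noteq> 1" by auto
    with pk have k: "k \<ge> 2" by simp
    have p: "real p \<ge> 2" using prime_ge_2_nat[OF pk(1)] by simp
    have "(real p)\<^sup>2 \<le> real p ^ k" using p k by (intro power_increasing) auto
    also have "\<dots> \<le> X" using n pk by simp
    finally have "real p \<le> sqrt X" by (rule real_le_rsqrt)
    moreover have "real k \<le> ln X / ln 2"
    proof -
      have "2 ^ k \<le> real p ^ k" using p by (intro power_mono) auto
      also have "\<dots> \<le> X" using n pk by simp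
      finally have "ln (2 ^ k) \<le> ln X" using X by (subst ln_le_cancel_iff) auto
      then show ?thesis by (simp add: ln_realpow field_simps)
    qed
    ultimately have "(p, k) \<in> ?A" by (simp add: le_nat_floor)
    then show "n \<in> (\<lambda>(p, k). p ^ k) ` ?A" using pk by force
  qed
  show "finite ?Q" by (rule finite_subset[OF sub]) auto
  have "card ?Q \<le> card ((\<lambda>(p, k). p ^ k) ` ?A)" by (rule card_mono[OF _ sub]) auto
  also have "\<dots> \<le> card ?A" by (rule card_image_le) auto
  finally have "card ?Q \<le> Suc (nat \<lfloor>sqrt X\<rfloor>) * Suc (nat \<lfloor>ln X / ln 2\<rfloor>)"
    by (simp only: card_cartesian_product card_atMost)
  then have "real (card ?Q) \<le> real (Suc (nat \<lfloor>sqrt X\<rfloor>)) * real (Suc (nat \<lfloor>ln X / ln 2\<rfloor>))"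
    by (simp only: of_nat_le_iff flip: of_nat_mult)
  also have "\<dots> \<le> (sqrt X + 1) * (ln X / ln 2 + 1)"
    using X by (intro mult_mono) auto
  finally show "real (card ?Q) \<le> (sqrt X + 1) * (ln X / ln 2 + 1)" .
qed

lemma prime_short_interval:
  assumes \<epsilon>: "\<epsilon> > 0"
  shows "\<forall>\<^sub>F y in at_top. \<exists>p::nat. prime p \<and> \<bar>y - ln (real p)\<bar> < \<epsilon>"
proof -
  obtain c where c: "c > 0"
    and ev: "\<forall>\<^sub>F y in at_top. c \<le> (\<Sum>n | n > 0 \<and> \<bar>y - ln (real n)\<bar> < \<epsilon>. mangoldt n / real n)"
    using mangoldt_short_interval[OF \<epsilon>] by blast
  \<comment> \<open>Bounds the whole sum if the interval contains no prime: a count of proper prime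
    powers up to \<open>exp (y + \<epsilon>)\<close> times the largest possible value of
    \<Lambda>(n)/n in the interval.\<close>
  define E where "E = (\<lambda>y. (sqrt (exp (y + \<epsilon>)) + 1) * ((y + \<epsilon>) / ln 2 + 1) * ((y + \<epsilon>) / exp (y - \<epsilon>)))"
  have "((\<lambda>y. (exp ((y + \<epsilon>) / 2) + 1) * ((y + \<epsilon>) / ln 2 + 1) * ((y + \<epsilon>) / exp (y - \<epsilon>))) \<longlongrightarrow> 0) at_top"
    by real_asymp
  moreover have "sqrt (exp (y + \<epsilon>)) = exp ((y + \<epsilon>) / 2)" for y
    by (rule real_sqrt_unique) (simp_all add: power2_eq_square flip: exp_add)
  ultimately have "(E \<longlongrightarrow> 0) at_top" by (simp add: E_def)
  then have "\<forall>\<^sub>F y in at_top. E y < c" using c by (rule order_tendstoD(2))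
  then show ?thesis using ev eventually_ge_at_top[of 0]
  proof eventually_elim
    case (elim y)
    let ?P = "{n. n > 0 \<and> \<bar>y - ln (real n)\<bar> < \<epsilon>}"
    let ?Q = "{n. real n \<le> exp (y + \<epsilon>) \<and> primepow n \<and> \<not> prime n}"
    have X: "exp (y + \<epsilon>) \<ge> 1" using elim \<epsilon> by simp
    note card = card_prime_powers_le[OF X]
    show ?case
    proof (rule ccontr)
      assume none: "\<not> ?case"
      have bounds: "exp (y - \<epsilon>) \<le> real n" "real n \<le> exp (y + \<epsilon>)" if "n \<in> ?P" for n
      proof -
        have n: "n > 0" "y - \<epsilon> \<le> ln (real n)" "ln (real n) \<le> y + \<epsilon>" using that by (auto simp: abs_less_iff)
        then show "exp (y - \<epsilon>) \<le> real n" "real n \<le> exp (y + \<epsilon>)"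
          by (metis exp_le_cancel_iff exp_ln of_nat_0_less_iff)+
      qed
      have fin: "finite ?P"
      proof (rule finite_subset)
        show "?P \<subseteq> {..nat \<lfloor>exp (y + \<epsilon>)\<rfloor>}" using bounds(2) by (auto simp: le_nat_floor)
      qed simp
      have "(\<Sum>n\<in>?P. mangoldt n / real n) = (\<Sum>n\<in>?P \<inter> ?Q. mangoldt n / real n)"
      proof (rule sum.mono_neutral_right[OF fin])
        show "\<forall>n\<in>?P - ?P \<inter> ?Q. mangoldt n / real n = 0"
        proof
          fix n assume n: "n \<in> ?P - ?P \<inter> ?Q"
          then have "real n \<le> exp (y + \<epsilon>)" "\<not> prime n" using bounds(2)[of n] none by auto
          then have "\<not> primepow n" using n by auto
          then show "mangoldt n / real n = 0" by (simp add: mangoldt_def)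
        qed
      qed simp
      also have "\<dots> \<le> (\<Sum>n\<in>?P \<inter> ?Q. (y + \<epsilon>) / exp (y - \<epsilon>))"
      proof (rule sum_mono)
        fix n assume "n \<in> ?P \<inter> ?Q"
        then have n: "n \<in> ?P" by simp
        have "mangoldt n \<le> ln (real n)" using n by (intro mangoldt_le) auto
        also have "\<dots> \<le> y + \<epsilon>" using n by (auto simp: abs_less_iff)
        finally show "mangoldt n / real n \<le> (y + \<epsilon>) / exp (y - \<epsilon>)"
          using bounds(1)[OF n] elim \<epsilon> by (intro frac_le) auto
      qed
      also have "\<dots> = real (card (?P \<inter> ?Q)) * ((y + \<epsilon>) / exp (y - \<epsilon>))" by simp
      also have "\<dots> \<le> ((sqrt (exp (y + \<epsilon>)) + 1) * (ln (exp (y + \<epsilon>)) / ln 2 + 1)) * ((y + \<epsilon>) / exp (y - \<epsilon>))"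
      proof (rule mult_right_mono)
        have "card (?P \<inter> ?Q) \<le> card ?Q" by (intro card_mono card(1)) auto
        then show "real (card (?P \<inter> ?Q)) \<le> (sqrt (exp (y + \<epsilon>)) + 1) * (ln (exp (y + \<epsilon>)) / ln 2 + 1)"
          using card(2) by linarith
      qed (use elim \<epsilon> in auto)
      also have "\<dots> = E y" by (simp add: E_def)
      finally show False using elim by linarith
    qed
  qed
qed

lemma prime_near_sqrt:
  assumes \<epsilon>: "\<epsilon> > 0"
  shows "\<forall>\<^sub>F N in sequentially. \<exists>p::nat. prime p \<and> p\<^sup>2 \<le> N \<and> exp (- \<epsilon>) * sqrt (real N) \<le> real p"
proof -
  \<comment> \<open>The centre is moved left by the radius \<open>\<epsilon> / 2\<close>, so that
    the prime found is at most \<open>sqrt N\<close>.\<close>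
  have "filterlim (\<lambda>N. ln (sqrt (real N)) - \<epsilon> / 2) at_top sequentially" by real_asymp
  from eventually_compose_filterlim[OF prime_short_interval[of "\<epsilon> / 2"] this] \<epsilon>
  have "\<forall>\<^sub>F N in sequentially. \<exists>p::nat. prime p \<and> \<bar>ln (sqrt (real N)) - \<epsilon> / 2 - ln (real p)\<bar> < \<epsilon> / 2" by simp
  then show ?thesis using eventually_gt_at_top[of 0]
  proof eventually_elim
    case (elim N)
    then obtain p :: nat where p: "prime p" "\<bar>ln (sqrt (real N)) - \<epsilon> / 2 - ln (real p)\<bar> < \<epsilon> / 2" by blast
    have p0: "real p > 0" using prime_gt_0_nat[OF p(1)] by simp
    have s0: "sqrt (real N) > 0" using elim by simp
    have "ln (real p) \<le> ln (sqrt (real N))" using p(2) by linarith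
    then have "real p \<le> sqrt (real N)" using p0 s0 by simp
    then have "(real p)\<^sup>2 \<le> (sqrt (real N))\<^sup>2" using p0 by (intro power_mono) auto
    then have "(real p)\<^sup>2 \<le> real N" by simp
    then have "p\<^sup>2 \<le> N" by (metis of_nat_le_iff of_nat_power)
    moreover have "exp (- \<epsilon>) * sqrt (real N) \<le> real p"
    proof -
      have "exp (- \<epsilon>) * sqrt (real N) = exp (ln (sqrt (real N)) - \<epsilon>)" using s0 by (simp add: exp_diff exp_minus field_simps)
      also have "\<dots> \<le> exp (ln (real p))" using p(2) by (subst exp_le_cancel_iff) linarith
      also have "\<dots> = real p" using p0 by simp
      finally show ?thesis .
    qed
    ultimately show ?case using p(1) by blast
  qed
qed

section \<open>Clique decompositions\<close>

lemma B_bound_eq: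
  assumes "N \<ge> 1"
  shows "B_bound N = real N * ((1 + sqrt (4 * real N - 3)) / 2)"
proof -
  let ?M = "(1 + sqrt (4 * real N - 3)) / 2"
  have "1 \<le> sqrt (4 * real N - 3)" using assms by simp
  then have M: "?M \<in> {1..}" by simp
  have "f_quad ?M = ((sqrt (4 * real N - 3))\<^sup>2 - 1) / 4"
    by (simp add: f_quad_def field_simps power2_eq_square del: real_sqrt_pow2_iff real_sqrt_mult_self)
  also have "\<dots> = real N - 1" using assms by simp
  finally have "the_inv_into {1..} f_quad (real N - 1) = ?M"
    using bij_betw_f_quad M by (intro the_inv_into_f_eq) (auto simp: bij_betw_def)
  then show ?thesis by (simp add: B_bound_def)
qed

lemma card_nsets_2:
  assumes "finite A"
  shows "2 * card ([A]\<^bsup>2\<^esup>) = card A * (card A - 1)"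
proof -
  have "card ([A]\<^bsup>2\<^esup>) = card A choose 2"
    using assms n_subsets[OF assms, of 2] by (simp add: nsets_def finite_subset conj_commute cong: conj_cong)
  moreover have "even (card A * (card A - 1))" by (cases "card A") simp_all
  ultimately show ?thesis by (simp add: choose_two)
qed

text \<open>Each pair of vertices lies in at most one clique, so the numbers of pairs inside the
  cliques add up to at most the number of pairs in \<open>V\<close>.\<close>

lemma clique_decomposition_sum_squares:
  assumes V: "simple_graph V E" "card V = N" and C: "clique_decomposition V E k C"
  shows "(\<Sum>i<k. card (C i) * (card (C i) - 1)) \<le> N * (N - 1)"
proof -
  have fV: "finite V" using V by (simp add: simple_graph_def)
  have sub: "C i \<subseteq> V" if "i < k" for i
    using C that by (auto simp: clique_decomposition_def is_clique_of_def)
  have fC: "finite (C i)" if "i < k" for i using sub[OF that] fV finite_subset by blast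
  have "(\<Sum>i<k. card (C i) * (card (C i) - 1)) = 2 * (\<Sum>i<k. card ([C i]\<^bsup>2\<^esup>))"
    unfolding sum_distrib_left by (intro sum.cong refl card_nsets_2[symmetric] fC) simp
  also have "(\<Sum>i<k. card ([C i]\<^bsup>2\<^esup>)) = card (\<Union>i<k. [C i]\<^bsup>2\<^esup>)"
    using C by (intro card_UN_disjoint'[symmetric]) (auto simp: clique_decomposition_def fC finite_imp_finite_nsets)
  also have "\<dots> \<le> card ([V]\<^bsup>2\<^esup>)"
    using sub nsets_mono by (intro card_mono finite_imp_finite_nsets fV) blast
  finally show ?thesis using card_nsets_2[OF fV] V by simp
qed

text \<open>Cauchy-Schwarz bounds the square of the sum \<open>S\<close> of the clique sizes by
  \<open>N\<close> times the sum of their squares. Together with the pair count this is a quadratic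
  inequality in \<open>S\<close>, whose larger root is \<open>B_bound N\<close>.\<close>

lemma T_max_le_B_bound:
  assumes N: "N \<ge> 1"
  shows "real (T_max N) \<le> B_bound N"
proof -
  have "T_max N \<in> clique_sums N"
    unfolding T_max_def by (intro Max_in finite_clique_sums clique_sums_nonempty)
  then obtain V :: "nat set" and E C where T: "T_max N = (\<Sum>i<N. card (C i))"
    and V: "simple_graph V E" "card V = N" and C: "clique_decomposition V E N C"
    by (auto simp: clique_sums_def)
  define m where "m = (\<lambda>i. real (card (C i)))"
  define S where "S = (\<Sum>i<N. m i)"
  have S: "real (T_max N) = S" by (simp add: T S_def m_def)
  have c: "real (c * (c - 1)) = (real c)\<^sup>2 - real c" for c :: nat
    by (cases c) (simp_all add: power2_eq_square algebra_simps)
  have "(\<Sum>i<N. (m i)\<^sup>2 - m i) = real (\<Sum>i<N. card (C i) * (card (C i) - 1))"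
    by (simp only: of_nat_sum m_def c)
  also have "\<dots> \<le> real (N * (N - 1))"
    using clique_decomposition_sum_squares[OF V C] by (simp only: of_nat_le_iff)
  also have "\<dots> = real N * (real N - 1)" using N by (simp add: of_nat_diff)
  finally have "(\<Sum>i<N. (m i)\<^sup>2) \<le> real N * (real N - 1) + S"
    by (simp add: sum_subtractf S_def)
  moreover have "S\<^sup>2 \<le> real N * (\<Sum>i<N. (m i)\<^sup>2)"
    using sum_squared_le_sum_of_squares[of m "{..<N}"] by (simp add: S_def mult.commute)
  ultimately have le: "S\<^sup>2 \<le> real N * (real N * (real N - 1) + S)"
    using mult_left_mono[of "\<Sum>i<N. (m i)\<^sup>2" "real N * (real N - 1) + S" "real N"] by linarith
  define r where "r = sqrt (4 * real N - 3)"
  have r: "r\<^sup>2 = 4 * real N - 3" "r \<ge> 0" using N by (simp_all add: r_def)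
  \<comment> \<open>Completing the square in the quadratic inequality \<open>le\<close>.\<close>
  have "(2 * S - real N)\<^sup>2 = 4 * S\<^sup>2 - 4 * real N * S + (real N)\<^sup>2" by (simp add: power2_eq_square algebra_simps)
  also have "\<dots> \<le> 4 * (real N * (real N * (real N - 1) + S)) - 4 * real N * S + (real N)\<^sup>2" using le by simp
  also have "\<dots> = (real N)\<^sup>2 * r\<^sup>2" unfolding r(1) by (simp add: power2_eq_square algebra_simps)
  finally have "(2 * S - real N)\<^sup>2 \<le> (real N * r)\<^sup>2" by (simp add: power_mult_distrib)
  then have "2 * S - real N \<le> real N * r" using r(2) by (intro power2_le_imp_le[of "2 * S - real N"]) auto
  then show ?thesis unfolding S B_bound_eq[OF N] r_def[symmetric] by (simp add: algebra_simps)
qed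

section \<open>Lower bound from affine planes\<close>

text \<open>The point \<open>(x, y)\<close> of the affine plane over the integers modulo \<open>q\<close> is encoded as \<open>x * q + y\<close>, and the line
  \<open>y = m * x + b\<close> has index \<open>m * q + b\<close>.\<close>

definition affine_line :: "nat \<Rightarrow> nat \<Rightarrow> nat set" where
  "affine_line q i = (\<lambda>x. x * q + ((i div q) * x + i mod q) mod q) ` {..<q}"

lemma card_affine_line:
  assumes q: "q > 0"
  shows "card (affine_line q i) = q"
proof -
  have "inj_on (\<lambda>x. x * q + ((i div q) * x + i mod q) mod q) {..<q}"
  proof (rule inj_onI)
    fix x x' assume "x * q + ((i div q) * x + i mod q) mod q = x' * q + ((i div q) * x' + i mod q) mod q"
    from arg_cong[OF this, of "\<lambda>n. n div q"] show "x = x'" using q by simp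
  qed
  then show ?thesis by (simp add: affine_line_def card_image)
qed

lemma affine_line_subset:
  assumes q: "q > 0"
  shows "affine_line q i \<subseteq> {..<q\<^sup>2}"
proof
  fix v assume "v \<in> affine_line q i"
  then obtain x where "x < q" "v = x * q + ((i div q) * x + i mod q) mod q"
    by (auto simp: affine_line_def)
  then obtain r where x: "x < q" "r < q" "v = x * q + r"
    using mod_less_divisor[OF q] by blast
  then have "v < x * q + q" by simp
  also have "\<dots> = Suc x * q" by simp
  also have "\<dots> \<le> q * q" using x by (intro mult_right_mono) auto
  finally show "v \<in> {..<q\<^sup>2}" by (simp add: power2_eq_square)
qed

text \<open>Subtracting the line equations at two common points shows that \<open>q\<close> divides
  the slope difference times the difference of abscissas. Primality makes the slopes equal, and then
  the intercepts agree.\<close>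

lemma affine_lines_meet:
  assumes q: "prime q" and i: "i < q\<^sup>2" and j: "j < q\<^sup>2"
    and u: "u \<in> affine_line q i" "u \<in> affine_line q j"
    and w: "w \<in> affine_line q i" "w \<in> affine_line q j" and ne: "u \<noteq> w"
  shows "i = j"
proof -
  have q0: "q > 0" using prime_gt_0_nat[OF q] .
  have mem: "v div q < q \<and> [int (v mod q) = int (k div q) * int (v div q) + int (k mod q)] (mod int q)"
    if "v \<in> affine_line q k" for v k
  proof -
    obtain x where x: "x < q" "v = x * q + ((k div q) * x + k mod q) mod q"
      using \<open>v \<in> affine_line q k\<close> by (auto simp: affine_line_def)
    have "v div q = x" "v mod q = ((k div q) * x + k mod q) mod q" using x q0 by auto
    then show ?thesis using x by (simp add: cong_def zmod_int)
  qed
  have mq: "k div q < q" if "k < q\<^sup>2" for k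
    using that by (simp add: power2_eq_square less_mult_imp_div_less)
  let ?a = "int (i div q) - int (j div q)" and ?b = "int (i mod q) - int (j mod q)"
  have eq: "int q dvd ?a * int (v div q) + ?b" if "v \<in> affine_line q i" "v \<in> affine_line q j" for v
  proof -
    have "[int (i div q) * int (v div q) + int (i mod q) = int (j div q) * int (v div q) + int (j mod q)] (mod int q)"
      using mem[OF that(1)] mem[OF that(2)] by (meson cong_sym cong_trans)
    then show ?thesis by (simp add: cong_iff_dvd_diff algebra_simps)
  qed
  have small: "x = y" if "int q dvd int x - int y" "x < q" "y < q" for x y
    using that by (metis cong_def cong_iff_dvd_diff cong_int_iff mod_less)
  \<comment> \<open>On a non-vertical line the abscissa determines the point.\<close>
  have xne: "u div q \<noteq> w div q"
  proof
    assume e: "u div q = w div q"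
    have "[int (u mod q) = int (w mod q)] (mod int q)"
      using mem[OF u(1)] mem[OF w(1)] e by (metis cong_sym cong_trans)
    then have "u mod q = w mod q" using q0 by (intro small) (auto simp: cong_iff_dvd_diff)
    with e ne show False by (metis div_mult_mod_eq)
  qed
  have "int q dvd (?a * int (u div q) + ?b) - (?a * int (w div q) + ?b)"
    using eq u w by (intro dvd_diff) auto
  then have "int q dvd ?a * (int (u div q) - int (w div q))" by (simp add: algebra_simps)
  moreover have "prime (int q)" using q by simp
  ultimately have "int q dvd ?a \<or> int q dvd int (u div q) - int (w div q)" by (simp add: prime_dvd_mult_iff)
  moreover have "\<not> int q dvd int (u div q) - int (w div q)"
    using small xne mem[OF u(1)] mem[OF w(1)] by blast
  ultimately have "int q dvd ?a" by simp
  then have d: "i div q = j div q" using mq i j by (intro small) auto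
  then have "int q dvd ?b" using eq[OF u] by simp
  then have "i mod q = j mod q" using q0 by (intro small) auto
  with d show ?thesis by (metis div_mult_mod_eq)
qed

lemma T_max_ge_prime_cube:
  assumes q: "prime q" and N: "q\<^sup>2 \<le> N"
  shows "q ^ 3 \<le> T_max N"
proof -
  have q0: "q > 0" using prime_gt_0_nat[OF q] .
  then have "q\<^sup>2 > 0" by simp
  with N have N0: "N > 0" by linarith
  \<comment> \<open>The surplus indices all receive the same single vertex, which is harmless
    because it carries no edge. Taking \<open>E\<close> as the union of the edge sets of the cliques
    makes them cover it.\<close>
  define C where "C = (\<lambda>i. if i < q\<^sup>2 then affine_line q i else {0})"
  define E where "E = (\<Union>i<N. [C i]\<^bsup>2\<^esup>)"
  have sub: "C i \<subseteq> {..<N}" for i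
    using affine_line_subset[OF q0, of i] N N0 by (auto simp: C_def)
  have "C i \<noteq> {}" for i using q0 by (auto simp: C_def affine_line_def)
  moreover have "clique (C i) E" if "i < N" for i
    using that by (force simp: clique_def E_def)
  moreover have "disjoint_family_on (\<lambda>i. [C i]\<^bsup>2\<^esup>) {..<N}"
    unfolding disjoint_family_on_def
  proof (intro ballI impI)
    fix i j :: nat assume ij: "i \<noteq> j"
    have False if ei: "e \<in> [C i]\<^bsup>2\<^esup>" and ej: "e \<in> [C j]\<^bsup>2\<^esup>" for e
    proof -
      obtain u w where e: "e = {u, w}" "u \<in> C i" "w \<in> C i" "u \<noteq> w" using ei by (rule nsets2_E)
      then have "u \<in> C j" "w \<in> C j" using ej by (auto simp: nsets_def)
      with e have "i < q\<^sup>2" "j < q\<^sup>2" by (auto simp: C_def split: if_splits)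
      with e \<open>u \<in> C j\<close> \<open>w \<in> C j\<close> show False using affine_lines_meet[OF q, of i j u w] ij by (simp add: C_def)
    qed
    then show "[C i]\<^bsup>2\<^esup> \<inter> [C j]\<^bsup>2\<^esup> = {}" by blast
  qed
  ultimately have dec: "clique_decomposition {..<N} E N C"
    using sub by (auto simp: clique_decomposition_def is_clique_of_def E_def)
  have gr: "simple_graph {..<N} E"
    using nsets_mono[OF sub] by (auto simp: simple_graph_def E_def)
  have "q ^ 3 = (\<Sum>i<q\<^sup>2. card (C i))"
    by (simp add: C_def card_affine_line q0 power3_eq_cube power2_eq_square)
  also have "\<dots> \<le> (\<Sum>i<N. card (C i))" using N by (intro sum_mono2) auto
  also have "\<dots> \<le> T_max N"
    unfolding T_max_def
  proof (rule Max_ge[OF finite_clique_sums])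
    show "(\<Sum>i<N. card (C i)) \<in> clique_sums N"
      unfolding clique_sums_def mem_Collect_eq
      by (intro exI[of _ "{..<N}"] exI[of _ E] exI[of _ C]) (simp add: gr dec)
  qed
  finally show ?thesis .
qed

theorem theorem3:
  shows "(\<lambda>N. real (T_max N) / B_bound N) \<longlonglongrightarrow> 1"
proof (rule order_tendstoI)
  have B0: "B_bound N > 0" if "N \<ge> 1" for N
    using that by (simp add: B_bound_eq add_pos_nonneg)
  show "\<forall>\<^sub>F N in sequentially. real (T_max N) / B_bound N < a" if "a > 1" for a
    using eventually_ge_at_top[of 1]
  proof eventually_elim
    case (elim N)
    have "real (T_max N) / B_bound N \<le> 1" using T_max_le_B_bound[OF elim] B0[OF elim] by simp
    then show ?case using that by linarith
  qed
  show "\<forall>\<^sub>F N in sequentially. a < real (T_max N) / B_bound N" if a: "a < 1" for a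
  proof -
    \<comment> \<open>The target ratio \<open>b\<close> lies strictly between \<open>max a 0\<close>
      and 1, and \<epsilon> spreads the loss over three factors: a prime
      \<open>p \<ge> exp (- \<epsilon>) * sqrt N\<close> has
      \<open>p ^ 3 \<ge> b * sqrt N ^ 3\<close>.\<close>
    define b where "b = (max a 0 + 1) / 2"
    define \<epsilon> where "\<epsilon> = - ln b / 3"
    have b: "a < b" "0 < b" "b < 1" using a by (auto simp: b_def)
    have \<epsilon>: "\<epsilon> > 0" "exp (- \<epsilon>) ^ 3 = b" using b by (auto simp: \<epsilon>_def simp flip: exp_of_nat_mult)
    \<comment> \<open>The denominator is \<open>B_bound N\<close> in closed form, asymptotic to
      \<open>sqrt N ^ 3\<close>.\<close>
    have "(\<lambda>N. b * sqrt (real N) ^ 3 / (real N * ((1 + sqrt (4 * real N - 3)) / 2))) \<longlonglongrightarrow> b"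
      by real_asymp
    then have "\<forall>\<^sub>F N in sequentially. a < b * sqrt (real N) ^ 3 / (real N * ((1 + sqrt (4 * real N - 3)) / 2))"
      using b(1) by (rule order_tendstoD(1))
    then show ?thesis using prime_near_sqrt[OF \<epsilon>(1)] eventually_ge_at_top[of 1]
    proof eventually_elim
      case (elim N)
      then obtain p where p: "prime p" "p\<^sup>2 \<le> N" "exp (- \<epsilon>) * sqrt (real N) \<le> real p" by blast
      have "(exp (- \<epsilon>) * sqrt (real N)) ^ 3 \<le> real p ^ 3" using p(3) by (intro power_mono) auto
      also have "\<dots> \<le> real (T_max N)" using T_max_ge_prime_cube[OF p(1,2)] by (simp flip: of_nat_power)
      finally have "b * sqrt (real N) ^ 3 / B_bound N \<le> real (T_max N) / B_bound N"
        using B0[of N] elim \<epsilon>(2) by (intro divide_right_mono) (auto simp: power_mult_distrib)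
      with elim show ?case by (simp add: B_bound_eq)
    qed
  qed
qed

end
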